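(* Let $\beta>0$ and let $m,n\to+\infty$ with $m/n\to\beta$. Let $Z$ be a non-negative integer-valued random variable such that $\mathbf{E} Z<\infty$ and $\mathbf{E} Z^2=\infty$, and let $\mathrm{P}$ denote the distribution of $\min\{Z,m\}$. Then the global clustering coefficient of the active random intersection graph $G=G(n,m,\mathrm{P})$ satisfies $C_G=o_P(1)$.
   Context: Active random intersection graph $G(n,m,\mathrm{P})$: the vertex set is $V=\{v_1,\dots,v_n\}$ and there is an auxiliary attribute set $W=\{w_1,\dots,w_m\}$. Each vertex $v\in V$ independently selects a random subset $S_v\subset W$ with $\mathbf{P}(S_v=A)=\mathrm{P}(|A|)\binom{m}{|A|}^{-1}$ for $A\subset W$, where $\mathrm{P}$ is a probability distribution on $\{0,1,\dots,m\}$ (so given $|S_v|$, $S_v$ is uniform among subsets of that size). Two distinct vertices $u,v$ are adjacent in $G$ iff $S_u\cap S_v\neq\emptyset$. For a graph $G$, the global clustering coefficient is $C_G=3\Delta/\Lambda$, where $\Delta$ is the number of triangles and $\Lambda$ is the number of paths of length $2$ in $G$. $o_P(1)$ denotes a quantity converging to $0$ in probability as $m,n\to\infty$. *)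

theory Defs
  imports "HOL-Probability.Probability"
begin

definition attr_pmf :: "nat \<Rightarrow> nat pmf \<Rightarrow> nat set pmf" where
  "attr_pmf m P = bind_pmf P (\<lambda>k. pmf_of_set {A. A \<subseteq> {..<m} \<and> card A = k})"

definition active_rig :: "nat \<Rightarrow> nat \<Rightarrow> nat pmf \<Rightarrow> (nat \<Rightarrow> nat set) pmf" where
  "active_rig n m P = Pi_pmf {..<n} {} (\<lambda>_. attr_pmf m P)"

definition rig_edge :: "(nat \<Rightarrow> nat set) \<Rightarrow> nat \<Rightarrow> nat \<Rightarrow> bool" where
  "rig_edge S u v \<longleftrightarrow> u \<noteq> v \<and> S u \<inter> S v \<noteq> {}"

definition num_triangles :: "'a set \<Rightarrow> ('a \<Rightarrow> 'a \<Rightarrow> bool) \<Rightarrow> nat" where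
  "num_triangles V E = card {T. T \<subseteq> V \<and> card T = 3 \<and> (\<forall>u\<in>T. \<forall>v\<in>T. u \<noteq> v \<longrightarrow> E u v)}"

definition num_paths2 :: "'a set \<Rightarrow> ('a \<Rightarrow> 'a \<Rightarrow> bool) \<Rightarrow> nat" where
  "num_paths2 V E = card {(v, P). v \<in> V \<and> P \<subseteq> V \<and> card P = 2 \<and> (\<forall>u\<in>P. E v u)}"

text \<open>Global clustering coefficient 3*Delta/Lambda (equal to 0 when Lambda = 0,
  by the convention x / 0 = 0).\<close>
definition clustering_coeff :: "'a set \<Rightarrow> ('a \<Rightarrow> 'a \<Rightarrow> bool) \<Rightarrow> real" where
  "clustering_coeff V E = 3 * real (num_triangles V E) / real (num_paths2 V E)"

end

theory Submission
  imports Defs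
begin

text \<open>
  Condition on the sizes \<open>x v = min (Z v) m\<close>; the attribute sets are then independent uniform
  subsets. Call \<open>v\<close> big if \<open>(x v)\<^sup>2 > m\<close>. Since \<open>Z\<close> is integrable there are
  \<open>o(sqrt m)\<close> big vertices and the squared sizes of the others add up to \<open>o(m sqrt m)\<close>; since
  \<open>Z\<^sup>2\<close> is not integrable, \<open>L = \<Sum> (x v)\<^sup>2\<close> is of larger order than \<open>n\<close>.

  The degree of \<open>v\<close> is at least of order \<open>x v\<close> outside an event of probability \<open>O(1 / x v)\<close>.
  Hence the number of 2-paths is at least of order \<open>L\<close>, as the exceptional vertices carry only
  \<open>O(\<Sum> x v) = O(n)\<close> of \<open>L\<close> in expectation.

  A triangle with two big vertices \<open>u\<close>, \<open>v\<close> is determined by \<open>v\<close> and an edge at \<open>u\<close>; there are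
  \<open>o(sqrt m)\<close> choices of \<open>v\<close> while \<open>u\<close> has degree of order at least \<open>sqrt m\<close>, so such triangles
  are negligible against the 2-paths centred at \<open>u\<close>. A triangle whose three vertices share an
  attribute occurs \<open>O(n)\<close> times in expectation. In every other triangle the three edges come from
  distinct attributes and two vertices are not big; the expected number of these is at most
  \<open>L (o(m sqrt m))\<^sup>2 / m\<^sup>3 = o(L)\<close>.
\<close>

section \<open>Tail bounds for discrete distributions\<close>

text \<open>The inner probability is at most 1 on the bad set \<open>B\<close> and at most
  \<open>r\<close> elsewhere. This removes conditioning: on the sizes, with \<open>B\<close> the
  atypical ones, and on the set of a single vertex, with \<open>B\<close> empty.\<close>

lemma prob_bind_pmf_le:
  assumes "\<And>x. x \<in> set_pmf p \<Longrightarrow> x \<notin> B \<Longrightarrow> measure_pmf.prob (q x) E \<le> r" and "0 \<le> r"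
  shows "measure_pmf.prob (bind_pmf p q) E \<le> measure_pmf.prob p B + r"
proof -
  have "emeasure (bind_pmf p q) E = (\<integral>\<^sup>+x. emeasure (q x) E \<partial>measure_pmf p)"
    by simp
  also have "\<dots> \<le> (\<integral>\<^sup>+x. indicator B x + ennreal r \<partial>measure_pmf p)"
  proof (intro nn_integral_mono_AE AE_pmfI)
    fix x assume x: "x \<in> set_pmf p"
    show "emeasure (q x) E \<le> indicator B x + ennreal r"
    proof (cases "x \<in> B")
      case True
      have "emeasure (q x) E \<le> 1" by (rule measure_pmf.emeasure_le_1)
      also have "1 \<le> 1 + ennreal r" by simp
      finally show ?thesis using True by simp
    next
      case False
      then show ?thesis
        using assms(1)[OF x] by (simp add: measure_pmf.emeasure_eq_measure ennreal_leI)
    qed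
  qed
  also have "\<dots> = emeasure p B + ennreal r"
    by (subst nn_integral_add) (auto simp: measure_pmf.emeasure_eq_measure)
  also have "\<dots> = ennreal (measure_pmf.prob p B + r)"
    using assms(2) by (simp add: measure_pmf.emeasure_eq_measure)
  finally show ?thesis
    using assms(2) by (simp add: measure_pmf.emeasure_eq_measure del: ennreal_plus)
qed

lemma prob_le_on_set_pmf:
  assumes "\<And>x. x \<in> set_pmf p \<Longrightarrow> x \<in> E \<Longrightarrow> x \<in> F"
  shows "measure_pmf.prob p E \<le> measure_pmf.prob p F"
proof -
  have "measure_pmf.prob p (E \<inter> set_pmf p) \<le> measure_pmf.prob p F"
    by (rule measure_pmf.finite_measure_mono) (use assms in auto)
  then show ?thesis by (simp add: measure_Int_set_pmf)
qed

lemma integrable_pmf_01: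
  fixes f :: "'a \<Rightarrow> real"
  assumes "\<And>x. x \<in> set_pmf p \<Longrightarrow> 0 \<le> f x \<and> f x \<le> 1"
  shows "integrable (measure_pmf p) f"
  by (rule measure_pmf.integrable_const_bound[where B = 1])
     (auto simp: AE_measure_pmf_iff dest: assms)

lemma markov_pmf:
  fixes f :: "'a \<Rightarrow> real"
  assumes "integrable (measure_pmf p) f" "\<And>x. x \<in> set_pmf p \<Longrightarrow> 0 \<le> f x"
    "measure_pmf.expectation p f \<le> r" "0 < t"
  shows "measure_pmf.prob p {x. t \<le> f x} \<le> r / t"
proof -
  have "measure_pmf.prob p {x\<in>space (measure_pmf p). t \<le> f x} \<le> measure_pmf.expectation p f / t"
    by (rule integral_Markov_inequality_measure[where A = UNIV])
       (use assms in \<open>auto simp: AE_measure_pmf_iff\<close>)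
  also have "\<dots> \<le> r / t"
    using assms by (simp add: divide_right_mono)
  finally show ?thesis by simp
qed

text \<open>A convex function lies below its chord, and the chord over [0,1] joins the values 1 and
  1/2.\<close>

lemma half_powr_le:
  fixes y :: real
  assumes "0 \<le> y" "y \<le> 1"
  shows "(1/2) powr y \<le> 1 - y / 2"
proof -
  have "convex_on UNIV (\<lambda>y::real. exp (y * ln (1/2)))"
  proof (rule f''_ge0_imp_convex)
    show "((\<lambda>y. exp (y * ln (1/2))) has_real_derivative ln (1/2) * exp (x * ln (1/2))) (at x)" for x :: real
      by (auto intro!: derivative_eq_intros)
    show "((\<lambda>y. ln (1/2) * exp (y * ln (1/2))) has_real_derivative ln (1/2) * ln (1/2) * exp (x * ln (1/2))) (at x)" for x :: real
      by (auto intro!: derivative_eq_intros)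
  qed auto
  from convex_onD[OF this, of y 0 1] assms show ?thesis
    by (simp add: powr_def)
qed

text \<open>A lower-tail Chernoff bound, obtained from Markov's inequality applied to \<open>2\<close> to the
  power minus the sum.\<close>

lemma prob_sum_Pi_pmf_le:
  fixes f :: "'i \<Rightarrow> 'b \<Rightarrow> real"
  assumes fin: "finite A" and J: "J \<subseteq> A"
    and f01: "\<And>v y. v \<in> J \<Longrightarrow> y \<in> set_pmf (p v) \<Longrightarrow> 0 \<le> f v y \<and> f v y \<le> 1"
    and mean: "\<And>v. v \<in> J \<Longrightarrow> q \<le> measure_pmf.expectation (p v) (f v)"
  shows "measure_pmf.prob (Pi_pmf A d p) {S. (\<Sum>v\<in>J. f v (S v)) \<le> q * card J / 4}
           \<le> exp (- (q * card J / 4))"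
proof -
  \<comment> \<open>Setting the factor to 1 off \<open>J\<close> turns the product over
    \<open>J\<close> into one over the whole index set \<open>A\<close>, where independence gives
    the expectation of the product.\<close>
  define g where "g v y = (if v \<in> J then (1/2) powr f v y else (1::real))" for v y
  have finJ: "finite J" using fin J finite_subset by blast
  have g01: "0 \<le> g v y \<and> g v y \<le> 1" if "y \<in> set_pmf (p v)" for v y
    using f01[of v y] that by (auto simp: g_def intro!: powr_le1)
  have Eg: "measure_pmf.expectation (p v) (g v) \<le> (if v \<in> J then exp (- q / 2) else 1)" for v
  proof (cases "v \<in> J")
    case True
    have "measure_pmf.expectation (p v) (g v) \<le> measure_pmf.expectation (p v) (\<lambda>y. 1 - f v y / 2)"
    proof (rule integral_mono_AE)
      show "integrable (measure_pmf (p v)) (g v)" by (rule integrable_pmf_01) (use g01 in auto)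
      show "integrable (measure_pmf (p v)) (\<lambda>y. 1 - f v y / 2)"
        using integrable_pmf_01[of "p v" "f v"] f01[OF True] by auto
      show "AE y in measure_pmf (p v). g v y \<le> 1 - f v y / 2"
        using half_powr_le f01[OF True] True by (auto simp: AE_measure_pmf_iff g_def)
    qed
    also have "\<dots> = 1 - measure_pmf.expectation (p v) (f v) / 2"
      using integrable_pmf_01[of "p v" "f v"] f01[OF True] by (subst Bochner_Integration.integral_diff) auto
    also have "\<dots> \<le> 1 + (- q / 2)" using mean[OF True] by simp
    also have "\<dots> \<le> exp (- q / 2)" by (rule exp_ge_add_one_self)
    finally show ?thesis using True by simp
  next
    case False
    then have "g v = (\<lambda>_. 1)" by (auto simp: g_def)
    then show ?thesis using False by simp
  qed
  let ?P = "Pi_pmf A d p"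
  have eq: "(\<Prod>v\<in>A. g v (S v)) = (1/2) powr (\<Sum>v\<in>J. f v (S v))" for S
  proof -
    have "(\<Prod>v\<in>A. g v (S v)) = (\<Prod>v\<in>J. (1/2) powr f v (S v))"
      using J fin by (intro prod.mono_neutral_cong_right) (auto simp: g_def)
    then show ?thesis by (simp add: powr_sum finJ)
  qed
  have E: "measure_pmf.expectation ?P (\<lambda>S. \<Prod>v\<in>A. g v (S v)) \<le> exp (- (q * card J / 2))"
  proof -
    have "measure_pmf.expectation ?P (\<lambda>S. \<Prod>v\<in>A. g v (S v)) = (\<Prod>v\<in>A. measure_pmf.expectation (p v) (g v))"
      by (rule expectation_prod_Pi_pmf[OF fin]) (auto intro!: integrable_pmf_01 simp: g01)
    also have "\<dots> \<le> (\<Prod>v\<in>A. if v \<in> J then exp (- q / 2) else 1)"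
      by (intro prod_mono conjI Eg integral_nonneg_AE) (auto simp: AE_measure_pmf_iff g01)
    also have "\<dots> = exp (- q / 2) ^ card J"
      using fin J by (simp add: prod.If_cases Int_absorb1)
    also have "\<dots> = exp (- (q * card J / 2))"
      by (simp add: exp_of_nat_mult[symmetric] mult.commute)
    finally show ?thesis .
  qed
  show ?thesis
  proof (cases "q \<ge> 0")
    case True
    \<comment> \<open>On the event the product is at least 2 to the power -q|J|/4, hence at least
      \<open>?t\<close> because ln 2 < 1. As the expected product is at most the square of
      \<open>?t\<close>, Markov's inequality leaves exactly \<open>?t\<close>.\<close>
    let ?t = "exp (- (q * card J / 4))"
    have "measure_pmf.prob ?P {S. (\<Sum>v\<in>J. f v (S v)) \<le> q * card J / 4}
       \<le> measure_pmf.prob ?P {S. ?t \<le> (\<Prod>v\<in>A. g v (S v))}"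
    proof (rule measure_pmf.finite_measure_mono, safe)
      fix S assume S: "(\<Sum>v\<in>J. f v (S v)) \<le> q * card J / 4"
      have "?t \<le> exp (- (ln 2 * (q * card J / 4)))"
        using ln_2_less_1 True by (auto intro!: mult_left_le_one_le)
      also have "\<dots> = (1/2) powr (q * card J / 4)"
        by (simp add: powr_def ln_div)
      also have "\<dots> \<le> (1/2) powr (\<Sum>v\<in>J. f v (S v))"
        using S by (intro powr_mono') auto
      finally show "?t \<le> (\<Prod>v\<in>A. g v (S v))" by (simp add: eq)
    qed simp
    also have "\<dots> \<le> exp (- (q * card J / 2)) / ?t"
      by (rule markov_pmf[OF _ _ E])
         (use fin in \<open>auto intro!: integrable_pmf_01 prod_nonneg prod_le_1 simp: set_Pi_pmf PiE_dflt_def g01\<close>)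
    also have "\<dots> = ?t" by (simp add: exp_diff[symmetric])
    finally show ?thesis .
  next
    \<comment> \<open>For negative \<open>q\<close> the claimed bound is at least 1.\<close>
    case False
    have "measure_pmf.prob ?P {S. (\<Sum>v\<in>J. f v (S v)) \<le> q * card J / 4} \<le> 1" by simp
    also have "1 \<le> exp (- (q * card J / 4))" 
      using False by (simp add: mult_le_0_iff)
    finally show ?thesis .
  qed
qed

section \<open>Uniform random subsets of fixed size\<close>

definition unif_subset :: "nat \<Rightarrow> nat \<Rightarrow> nat set pmf" where
  "unif_subset m k = pmf_of_set {A. A \<subseteq> {..<m} \<and> card A = k}"

lemma unif_subset_domain:
  assumes "k \<le> m"
  shows "finite {A. A \<subseteq> {..<m} \<and> card A = k}" "{A. A \<subseteq> {..<m} \<and> card A = k} \<noteq> {}"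
proof -
  show "finite {A. A \<subseteq> {..<m} \<and> card A = k}" by simp
  have "{..<k} \<in> {A. A \<subseteq> {..<m} \<and> card A = k}" using assms by auto
  then show "{A. A \<subseteq> {..<m} \<and> card A = k} \<noteq> {}" by blast
qed

lemma set_unif_subset:
  "k \<le> m \<Longrightarrow> set_pmf (unif_subset m k) = {A. A \<subseteq> {..<m} \<and> card A = k}"
  unfolding unif_subset_def using unif_subset_domain by (intro set_pmf_of_set)

text \<open>Removing \<open>B\<close> is a bijection onto the subsets of \<open>M - B\<close> with
  \<open>k - card B\<close> elements; adding \<open>B\<close> back is its inverse.\<close>

lemma card_supersets:
  assumes "finite M" "B \<subseteq> M" "card B \<le> k"
  shows "card {A. B \<subseteq> A \<and> A \<subseteq> M \<and> card A = k} = (card M - card B) choose (k - card B)"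
proof -
  have finB: "finite B" using assms finite_subset by blast
  have "bij_betw (\<lambda>A. A - B) {A. B \<subseteq> A \<and> A \<subseteq> M \<and> card A = k}
          {A. A \<subseteq> M - B \<and> card A = k - card B}"
  proof (rule bij_betw_byWitness[where f' = "\<lambda>A. A \<union> B"])
    show "(\<lambda>A. A - B) ` {A. B \<subseteq> A \<and> A \<subseteq> M \<and> card A = k} \<subseteq> {A. A \<subseteq> M - B \<and> card A = k - card B}"
      using finB by (auto simp: card_Diff_subset)
    have "card (A \<union> B) = k" if "A \<subseteq> M - B" "card A = k - card B" for A
    proof -
      have "card (A \<union> B) = card A + card B"
        using that assms finB by (intro card_Un_disjoint) (auto intro: finite_subset)
      then show ?thesis using that assms by simp
    qed
    then show "(\<lambda>A. A \<union> B) ` {A. A \<subseteq> M - B \<and> card A = k - card B} \<subseteq> {A. B \<subseteq> A \<and> A \<subseteq> M \<and> card A = k}"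
      using assms by auto
  qed auto
  then have "card {A. B \<subseteq> A \<and> A \<subseteq> M \<and> card A = k} = card {A. A \<subseteq> M - B \<and> card A = k - card B}"
    by (rule bij_betw_same_card)
  also have "\<dots> = card (M - B) choose (k - card B)"
    using assms by (intro n_subsets) auto
  finally show ?thesis using assms finB by (simp add: card_Diff_subset)
qed

text \<open>A quotient of two counts. Without \<open>card B \<le> k\<close>, truncated subtraction
  would turn the numerator into 1 although no such superset exists.\<close>

lemma prob_unif_subset_supset:
  assumes "k \<le> m" "B \<subseteq> {..<m}" "card B \<le> k"
  shows "measure_pmf.prob (unif_subset m k) {A. B \<subseteq> A}
           = ((m - card B) choose (k - card B)) / (m choose k)"
proof -
  let ?D = "{A. A \<subseteq> {..<m} \<and> card A = k}"
  have "?D \<inter> {A. B \<subseteq> A} = {A. B \<subseteq> A \<and> A \<subseteq> {..<m} \<and> card A = k}" by auto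
  then show ?thesis
    using assms card_supersets[of "{..<m}" B k] n_subsets[of "{..<m}" k]
    by (simp add: unif_subset_def measure_pmf_of_set[OF unif_subset_domain(2,1)])
qed

lemma prob_unif_subset_mem:
  assumes "k \<le> m" "a < m"
  shows "measure_pmf.prob (unif_subset m k) {A. a \<in> A} = k / m"
proof (cases "k = 0")
  case True
  have "measure_pmf.prob (unif_subset m k) {A. a \<in> A} \<le> measure_pmf.prob (unif_subset m k) {}"
    by (rule prob_le_on_set_pmf) (use True assms in \<open>auto simp: set_unif_subset finite_subset\<close>)
  then show ?thesis using True by (simp add: measure_le_0_iff)
next
  case False
  then obtain k' m' where km: "k = Suc k'" "m = Suc m'"
    using assms by (metis gr0_implies_Suc neq0_conv not_less0)
  have "Suc k' * (Suc m' choose Suc k') = Suc m' * (m' choose k')"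
    by (rule Suc_times_binomial)
  then have "real (Suc k') * real (Suc m' choose Suc k') = real (Suc m') * real (m' choose k')"
    by (metis of_nat_mult)
  moreover have "(Suc m' choose Suc k') > 0" using assms km by simp
  ultimately have "real (m' choose k') / real (Suc m' choose Suc k') = real (Suc k') / real (Suc m')"
    by (simp add: field_simps del: of_nat_Suc binomial_Suc_Suc)
  then show ?thesis
    using prob_unif_subset_supset[of k m "{a}"] assms km by (simp del: of_nat_Suc binomial_Suc_Suc)
qed

text \<open>Memberships of distinct attributes are negatively correlated: for k at least 2 the exact
  value is k(k-1) / (m(m-1)), and (k-1)/(m-1) <= k/m because k <= m.\<close>

lemma prob_unif_subset_mem2_le:
  assumes "k \<le> m" "a < m" "b < m" "a \<noteq> b"
  shows "measure_pmf.prob (unif_subset m k) {A. a \<in> A \<and> b \<in> A} \<le> (k / m)\<^sup>2"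
proof (cases "k < 2")
  case True
  have "measure_pmf.prob (unif_subset m k) {A. a \<in> A \<and> b \<in> A} \<le> measure_pmf.prob (unif_subset m k) {}"
  proof (rule prob_le_on_set_pmf)
    fix A assume "A \<in> set_pmf (unif_subset m k)" "A \<in> {A. a \<in> A \<and> b \<in> A}"
    then have "{a, b} \<subseteq> A" "finite A" "card A = k"
      using assms by (auto simp: set_unif_subset intro: finite_subset)
    then have "card {a, b} \<le> k" using card_mono by blast
    then show "A \<in> {}" using True assms by simp
  qed
  then show ?thesis by (simp add: order_trans[OF _ zero_le_power2])
next
  case False
  then obtain k' m' where km: "k = Suc (Suc k')" "m = Suc (Suc m')"
    using assms by (metis One_nat_def Suc_1 Suc_le_D not_less le_trans Suc_le_mono)
  have "Suc (Suc k') * (Suc (Suc m') choose Suc (Suc k')) = Suc (Suc m') * (Suc m' choose Suc k')"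
    by (rule Suc_times_binomial)
  then have 1: "real (Suc (Suc k')) * real (Suc (Suc m') choose Suc (Suc k')) = real (Suc (Suc m')) * real (Suc m' choose Suc k')"
    by (metis of_nat_mult)
  have "Suc k' * (Suc m' choose Suc k') = Suc m' * (m' choose k')"
    by (rule Suc_times_binomial)
  then have 2: "real (Suc k') * real (Suc m' choose Suc k') = real (Suc m') * real (m' choose k')"
    by (metis of_nat_mult)
  have "k' \<le> m'" using assms km by simp
  then have pos: "(Suc (Suc m') choose Suc (Suc k')) > 0" "(Suc m' choose Suc k') > 0"
    by (simp_all del: binomial_Suc_Suc)
  have "real (m' choose k') / real (Suc (Suc m') choose Suc (Suc k'))
      = (real (m' choose k') / real (Suc m' choose Suc k')) * (real (Suc m' choose Suc k') / real (Suc (Suc m') choose Suc (Suc k')))"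
    using pos by (simp del: of_nat_Suc binomial_Suc_Suc)
  also have "real (m' choose k') / real (Suc m' choose Suc k') = real (Suc k') / real (Suc m')"
    using 2 pos by (simp add: field_simps del: of_nat_Suc binomial_Suc_Suc)
  also have "real (Suc m' choose Suc k') / real (Suc (Suc m') choose Suc (Suc k')) = real k / real m"
    using 1 pos km by (simp add: field_simps del: of_nat_Suc binomial_Suc_Suc)
  also have "real (Suc k') / real (Suc m') * (real k / real m) \<le> real k / real m * (real k / real m)"
    using \<open>k' \<le> m'\<close> km by (intro mult_right_mono) (auto simp: field_simps)
  finally have "real (m' choose k') / real (Suc (Suc m') choose Suc (Suc k')) \<le> (k / m)\<^sup>2"
    by (simp add: power2_eq_square mult_right_mono del: of_nat_Suc binomial_Suc_Suc)
  moreover have "{A. a \<in> A \<and> b \<in> A} = {A. {a, b} \<subseteq> A}" by auto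
  ultimately show ?thesis
    using prob_unif_subset_supset[of k m "{a, b}"] assms km False by (simp del: of_nat_Suc binomial_Suc_Suc)
qed

section \<open>Deterministic counting of 2-paths and triangles\<close>

definition rig_degree :: "nat \<Rightarrow> (nat \<Rightarrow> nat set) \<Rightarrow> nat \<Rightarrow> nat" where
  "rig_degree n S u = card {v \<in> {..<n}. rig_edge S u v}"

text \<open>A 2-path is its centre together with an unordered pair of neighbours.\<close>

lemma num_paths2_eq_sum_degrees:
  "num_paths2 {..<n} (rig_edge S) = (\<Sum>u<n. rig_degree n S u choose 2)"
proof -
  have "{(v, P). v \<in> {..<n} \<and> P \<subseteq> {..<n} \<and> card P = 2 \<and> (\<forall>u\<in>P. rig_edge S v u)}
      = (SIGMA v:{..<n}. {P. P \<subseteq> {u \<in> {..<n}. rig_edge S v u} \<and> card P = 2})"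
    by auto
  then show ?thesis
    by (simp add: num_paths2_def rig_degree_def n_subsets)
qed

text \<open>Attributes are read as colours of edges. The two index sets consist of ordered tuples, so each
  triangle is counted several times, which is harmless for upper bounds.\<close>

definition monochrome_triangles :: "nat \<Rightarrow> nat \<Rightarrow> (nat \<times> nat \<times> nat \<times> nat) set" where
  "monochrome_triangles n m = {(a, u, v, w). a < m \<and> u < n \<and> v < n \<and> w < n \<and> u \<noteq> v \<and> u \<noteq> w \<and> v \<noteq> w}"

definition rainbow_triangles ::
  "nat \<Rightarrow> nat \<Rightarrow> nat set \<Rightarrow> ((nat \<times> nat \<times> nat) \<times> nat \<times> nat \<times> nat) set" where
  "rainbow_triangles n m B = {((a, b, c), u, v, w). a < m \<and> b < m \<and> c < m \<and> a \<noteq> b \<and> a \<noteq> c \<and> b \<noteq> c \<and>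
     u < n \<and> v < n \<and> w < n \<and> u \<noteq> v \<and> u \<noteq> w \<and> v \<noteq> w \<and> v \<notin> B \<and> w \<notin> B}"

definition num_monochrome :: "nat \<Rightarrow> nat \<Rightarrow> (nat \<Rightarrow> nat set) \<Rightarrow> nat" where
  "num_monochrome n m S = card {(a, u, v, w) \<in> monochrome_triangles n m. a \<in> S u \<and> a \<in> S v \<and> a \<in> S w}"

definition num_rainbow :: "nat \<Rightarrow> nat \<Rightarrow> nat set \<Rightarrow> (nat \<Rightarrow> nat set) \<Rightarrow> nat" where
  "num_rainbow n m B S = card {((a, b, c), u, v, w) \<in> rainbow_triangles n m B.
     {a, b} \<subseteq> S u \<and> {a, c} \<subseteq> S v \<and> {b, c} \<subseteq> S w}"

lemma finite_monochrome_triangles: "finite (monochrome_triangles n m)"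
  by (rule finite_subset[of _ "{..<m} \<times> {..<n} \<times> {..<n} \<times> {..<n}"]) (auto simp: monochrome_triangles_def)

lemma finite_rainbow_triangles: "finite (rainbow_triangles n m B)"
  by (rule finite_subset[of _ "({..<m} \<times> {..<m} \<times> {..<m}) \<times> {..<n} \<times> {..<n} \<times> {..<n}"])
     (auto simp: rainbow_triangles_def)

text \<open>Pigeonhole: two of three vertices lie on the same side of \<open>B\<close>. In the
  second case the remaining vertex comes first, matching \<open>rainbow_triangles\<close>, where
  only \<open>v\<close> and \<open>w\<close> must avoid \<open>B\<close>.\<close>

lemma card_3_two_in_or_two_out:
  assumes "card T = 3"
  obtains u v w where "T = {u, v, w}" "u \<noteq> v" "u \<noteq> w" "v \<noteq> w" "u \<in> B" "v \<in> B"
  | u v w where "T = {u, v, w}" "u \<noteq> v" "u \<noteq> w" "v \<noteq> w" "v \<notin> B" "w \<notin> B"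
proof -
  from assms obtain x y z where T: "T = {x, y, z}" "x \<noteq> y" "x \<noteq> z" "y \<noteq> z"
    by (auto simp: card_3_iff)
  consider "x \<in> B" "y \<in> B" | "x \<in> B" "z \<in> B" | "y \<in> B" "z \<in> B"
    | "x \<notin> B" "y \<notin> B" | "x \<notin> B" "z \<notin> B" | "y \<notin> B" "z \<notin> B" by blast
  then show thesis
  proof cases
    case 1 show ?thesis by (rule that(1)[of x y z]) (use T 1 in auto)
  next
    case 2 show ?thesis by (rule that(1)[of x z y]) (use T 2 in auto)
  next
    case 3 show ?thesis by (rule that(1)[of y z x]) (use T 3 in auto)
  next
    case 4 show ?thesis by (rule that(2)[of z x y]) (use T 4 in auto)
  next
    case 5 show ?thesis by (rule that(2)[of y x z]) (use T 5 in auto)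
  next
    case 6 show ?thesis by (rule that(2)[of x y z]) (use T 6 in auto)
  qed
qed

text \<open>Every triangle is the vertex set of a tuple of one of three kinds: two vertices in
  \<open>B\<close>, a common attribute of all three vertices, or three distinct edge attributes with
  two vertices outside \<open>B\<close>.\<close>

lemma num_triangles_le:
  assumes B: "B \<subseteq> {..<n}" and S: "\<And>v. v < n \<Longrightarrow> S v \<subseteq> {..<m}"
  shows "num_triangles {..<n} (rig_edge S)
     \<le> card B * (\<Sum>u\<in>B. rig_degree n S u) + num_monochrome n m S + num_rainbow n m B S"
proof -
  let ?T = "{T. T \<subseteq> {..<n} \<and> card T = 3 \<and> (\<forall>u\<in>T. \<forall>v\<in>T. u \<noteq> v \<longrightarrow> rig_edge S u v)}"
  \<comment> \<open>Only the edge from \<open>u\<close> to \<open>w\<close> is recorded; ignoring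
    the two edges at \<open>v\<close> overcounts but makes the cardinality a product.\<close>
  define X1 where "X1 = (SIGMA u:B. B \<times> {w \<in> {..<n}. rig_edge S u w})"
  define X2 where "X2 = {(a, u, v, w) \<in> monochrome_triangles n m. a \<in> S u \<and> a \<in> S v \<and> a \<in> S w}"
  define X3 where "X3 = {((a, b, c), u, v, w) \<in> rainbow_triangles n m B.
     {a, b} \<subseteq> S u \<and> {a, c} \<subseteq> S v \<and> {b, c} \<subseteq> S w}"
  define f1 where "f1 = (\<lambda>(u, v, w). {u, v, w} :: nat set)"
  define f2 where "f2 = (\<lambda>(a::nat, u, v, w). {u, v, w} :: nat set)"
  define f3 where "f3 = (\<lambda>(_::nat\<times>nat\<times>nat, u, v, w). {u, v, w} :: nat set)"
  have finB: "finite B" using B finite_subset by blast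
  have fin: "finite X1" "finite X2" "finite X3"
    using finB finite_monochrome_triangles[of n m] finite_rainbow_triangles[of n m B]
    by (auto simp: X1_def X2_def X3_def elim!: rev_finite_subset)
  have "?T \<subseteq> f1 ` X1 \<union> f2 ` X2 \<union> f3 ` X3"
  proof
    fix T assume T: "T \<in> ?T"
    then have "card T = 3" by simp
    then show "T \<in> f1 ` X1 \<union> f2 ` X2 \<union> f3 ` X3"
    proof (cases rule: card_3_two_in_or_two_out[where B = B])
      case (1 u v w)
      then have "(u, v, w) \<in> X1" using T by (auto simp: X1_def)
      moreover have "T = f1 (u, v, w)" using 1 by (simp add: f1_def)
      ultimately show ?thesis by blast
    next
      case (2 u v w)
      then have e: "rig_edge S u v" "rig_edge S u w" "rig_edge S v w" and n: "u < n" "v < n" "w < n"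
        using T by auto
      from e obtain a b c where abc: "a \<in> S u" "a \<in> S v" "b \<in> S u" "b \<in> S w" "c \<in> S v" "c \<in> S w"
        unfolding rig_edge_def by blast
      then have m: "a < m" "b < m" "c < m" using S n by blast+
      show ?thesis
      proof (cases "a \<noteq> b \<and> a \<noteq> c \<and> b \<noteq> c")
        case True
        then have "((a, b, c), u, v, w) \<in> X3"
          using 2 n m abc by (auto simp: X3_def rainbow_triangles_def)
        moreover have "T = f3 ((a, b, c), u, v, w)" using 2 by (simp add: f3_def)
        ultimately show ?thesis by blast
      next
        case False
        \<comment> \<open>If two of the three edge attributes coincide, the two edges together cover
          all three vertices, so the common value belongs to every one of the sets.\<close>
        then obtain d where "d < m" "d \<in> S u" "d \<in> S v" "d \<in> S w" using abc m by metis
        then have "(d, u, v, w) \<in> X2"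
          using 2 n by (auto simp: X2_def monochrome_triangles_def)
        moreover have "T = f2 (d, u, v, w)" using 2 by (simp add: f2_def)
        ultimately show ?thesis by blast
      qed
    qed
  qed
  then have "card ?T \<le> card (f1 ` X1 \<union> f2 ` X2 \<union> f3 ` X3)"
    using fin by (intro card_mono) auto
  also have "\<dots> \<le> card (f1 ` X1) + card (f2 ` X2) + card (f3 ` X3)"
    by (meson card_Un_le add_le_mono1 le_trans)
  also have "\<dots> \<le> card X1 + card X2 + card X3"
    using fin by (intro add_mono card_image_le)
  also have "card X1 = card B * (\<Sum>u\<in>B. rig_degree n S u)"
    using finB by (simp add: X1_def rig_degree_def card_cartesian_product sum_distrib_left)
  finally show ?thesis
    by (simp add: num_triangles_def num_monochrome_def num_rainbow_def X2_def X3_def)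
qed

text \<open>d(d-1)/2 >= d^2/4 holds as soon as d >= 2, which is where the 2 in
  \<open>low_degree\<close> comes from.\<close>

lemma choose_two_ge:
  assumes "2 \<le> d"
  shows "real d * real d / 4 \<le> real (d choose 2)"
proof -
  have "real (d choose 2) = real d * (real d - 1) / 2"
    using assms by (subst choose_two, subst real_of_nat_div) (auto simp: of_nat_diff)
  moreover have "real d * real d / 4 \<le> real d * (real d - 1) / 2"
    using assms mult_left_mono[of "real d * 2" "real d * real d" 1] by (simp add: field_simps)
  ultimately show ?thesis by simp
qed

lemma sum_triple_product:
  fixes f g h :: "_ \<Rightarrow> real"
  shows "(\<Sum>(u, v, w)\<in>A \<times> B \<times> C. f u * g v * h w) = sum f A * sum g B * sum h C"
proof -
  have "(\<Sum>(u, v, w)\<in>A \<times> B \<times> C. f u * g v * h w) = (\<Sum>u\<in>A. \<Sum>v\<in>B. \<Sum>w\<in>C. f u * g v * h w)"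
    by (simp add: sum.cartesian_product)
  also have "\<dots> = sum f A * sum g B * sum h C"
    by (simp only: sum_distrib_left[symmetric] sum_distrib_right[symmetric])
  finally show ?thesis .
qed

section \<open>The random graph conditioned on the sizes of the attribute sets\<close>

locale sized_rig =
  fixes n m :: nat and x :: "nat \<Rightarrow> nat"
  assumes x_le: "\<And>v. v < n \<Longrightarrow> x v \<le> m" and m_pos: "0 < m"
begin

definition Q :: "(nat \<Rightarrow> nat set) pmf" where
  "Q = Pi_pmf {..<n} {} (\<lambda>v. unif_subset m (x v))"

text \<open>The cutoff is sqrt m, the size at which two independent sets share one attribute on
  average; squaring keeps the condition within the naturals.\<close>

definition big :: "nat set" where
  "big = {v \<in> {..<n}. m < (x v)\<^sup>2}"

lemma set_Q: "S \<in> set_pmf Q \<Longrightarrow> v < n \<Longrightarrow> S v \<subseteq> {..<m} \<and> card (S v) = x v"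
  using set_unif_subset[OF x_le, of v] by (auto simp: Q_def set_Pi_pmf PiE_dflt_def)

lemma finite_set_Q: "finite (set_pmf Q)"
  unfolding Q_def
  by (subst set_Pi_pmf, simp, rule finite_PiE_dflt) (auto simp: set_unif_subset x_le)

lemma integrable_Q [simp]: "integrable (measure_pmf Q) (f :: _ \<Rightarrow> real)"
  by (rule integrable_measure_pmf_finite[OF finite_set_Q])

lemma expectation_card_Q:
  assumes "finite I"
  shows "measure_pmf.expectation Q (\<lambda>S. real (card {i \<in> I. R i S}))
           = (\<Sum>i\<in>I. measure_pmf.prob Q {S. R i S})"
proof -
  have "real (card {i \<in> I. R i S}) = (\<Sum>i\<in>I. indicator {S. R i S} S)" for S
    using assms by (simp add: indicator_def sum.If_cases Int_def)
  then show ?thesis by simp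
qed

lemma prob_three_independent:
  assumes "u < n" "v < n" "w < n" "u \<noteq> v" "u \<noteq> w" "v \<noteq> w"
  shows "measure_pmf.prob Q {S. S u \<in> F \<and> S v \<in> G \<and> S w \<in> H}
    = measure_pmf.prob (unif_subset m (x u)) F * measure_pmf.prob (unif_subset m (x v)) G
      * measure_pmf.prob (unif_subset m (x w)) H"
proof -
  \<comment> \<open>With \<open>UNIV\<close> at all other vertices the event is a product set over
    all \<open>n\<close> coordinates, and the additional factors equal 1.\<close>
  define K where "K i = (if i = u then F else if i = v then G else if i = w then H else UNIV)" for i
  have "{S. S u \<in> F \<and> S v \<in> G \<and> S w \<in> H} = Pi {..<n} K"
  proof (intro equalityI subsetI)
    fix S assume "S \<in> Pi {..<n} K"
    then have "S u \<in> K u" "S v \<in> K v" "S w \<in> K w" using assms by auto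
    then show "S \<in> {S. S u \<in> F \<and> S v \<in> G \<and> S w \<in> H}" using assms by (simp add: K_def)
  qed (simp add: K_def)
  then have "measure_pmf.prob Q {S. S u \<in> F \<and> S v \<in> G \<and> S w \<in> H}
     = (\<Prod>i<n. measure_pmf.prob (unif_subset m (x i)) (K i))"
    by (simp add: Q_def measure_Pi_pmf_Pi)
  also have "\<dots> = (\<Prod>i\<in>{u, v, w}. measure_pmf.prob (unif_subset m (x i)) (K i))"
    using assms by (intro prod.mono_neutral_right) (auto simp: K_def)
  also have "\<dots> = measure_pmf.prob (unif_subset m (x u)) F * measure_pmf.prob (unif_subset m (x v)) G
      * measure_pmf.prob (unif_subset m (x w)) H"
    using assms by (simp add: K_def)
  finally show ?thesis .
qed

text \<open>Each vertex holds a given attribute with probability x/m. Once the distinctness of the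
  vertices is dropped, the sum factorizes, and the \<open>m\<close> choices of attribute against the
  factor m^(-3) leave m^(-2).\<close>

lemma expectation_num_monochrome_le:
  "measure_pmf.expectation Q (\<lambda>S. real (num_monochrome n m S)) \<le> (\<Sum>v<n. real (x v)) ^ 3 / real m ^ 2"
proof -
  let ?D = "{..<m} \<times> {..<n} \<times> {..<n} \<times> {..<n}"
  let ?R = "\<lambda>(a, u, v, w) S. a \<in> S u \<and> a \<in> S v \<and> a \<in> S w"
  have "measure_pmf.expectation Q (\<lambda>S. real (num_monochrome n m S))
      = measure_pmf.expectation Q (\<lambda>S. real (card {i \<in> monochrome_triangles n m. ?R i S}))"
    by (simp add: num_monochrome_def case_prod_beta' conj_commute)
  also have "\<dots> = (\<Sum>i\<in>monochrome_triangles n m. measure_pmf.prob Q {S. ?R i S})"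
    by (rule expectation_card_Q[OF finite_monochrome_triangles])
  also have "\<dots> = (\<Sum>(a, u, v, w)\<in>monochrome_triangles n m. x u / m * (x v / m) * (x w / m))"
  proof (rule sum.cong, simp, clarify)
    fix a u v w assume "(a, u, v, w) \<in> monochrome_triangles n m"
    then show "measure_pmf.prob Q {S. a \<in> S u \<and> a \<in> S v \<and> a \<in> S w} = x u / m * (x v / m) * (x w / m)"
      using prob_three_independent[of u v w "{A. a \<in> A}" "{A. a \<in> A}" "{A. a \<in> A}"]
      by (simp add: monochrome_triangles_def prob_unif_subset_mem x_le)
  qed
  also have "\<dots> \<le> (\<Sum>(a, u, v, w)\<in>?D. x u / m * (x v / m) * (x w / m))"
    by (rule sum_mono2) (auto simp: monochrome_triangles_def)
  also have "\<dots> = (\<Sum>a<m. \<Sum>(u, v, w)\<in>{..<n} \<times> {..<n} \<times> {..<n}. x u / m * (x v / m) * (x w / m))"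
    by (subst sum.cartesian_product) (simp add: case_prod_beta')
  also have "\<dots> = real m * ((\<Sum>u<n. x u / m) * (\<Sum>v<n. x v / m) * (\<Sum>w<n. x w / m))"
    unfolding sum_triple_product by simp
  also have "\<dots> = (\<Sum>v<n. real (x v)) ^ 3 / real m ^ 2"
    using m_pos by (simp add: sum_divide_distrib[symmetric] power2_eq_square power3_eq_cube)
  finally show ?thesis .
qed

text \<open>Distinct attributes let each vertex contribute at most (x/m)^2. The m^3 attribute
  triples against m^(-6) leave m^(-3); only the first vertex may lie in \<open>B\<close>, so only
  its sum is unrestricted.\<close>

lemma expectation_num_rainbow_le:
  "measure_pmf.expectation Q (\<lambda>S. real (num_rainbow n m B S))
     \<le> (\<Sum>v<n. real (x v) ^ 2) * (\<Sum>v\<in>{..<n} - B. real (x v) ^ 2) ^ 2 / real m ^ 3"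
proof -
  let ?D = "({..<m} \<times> {..<m} \<times> {..<m}) \<times> {..<n} \<times> ({..<n} - B) \<times> ({..<n} - B)"
  let ?R = "\<lambda>((a, b, c), u, v, w) S. {a, b} \<subseteq> S u \<and> {a, c} \<subseteq> S v \<and> {b, c} \<subseteq> S w"
  let ?p = "\<lambda>u. (x u / m)\<^sup>2"
  have "measure_pmf.expectation Q (\<lambda>S. real (num_rainbow n m B S))
      = measure_pmf.expectation Q (\<lambda>S. real (card {i \<in> rainbow_triangles n m B. ?R i S}))"
    by (simp add: num_rainbow_def case_prod_beta' conj_commute)
  also have "\<dots> = (\<Sum>i\<in>rainbow_triangles n m B. measure_pmf.prob Q {S. ?R i S})"
    by (rule expectation_card_Q[OF finite_rainbow_triangles])
  also have "\<dots> \<le> (\<Sum>((a, b, c), u, v, w)\<in>rainbow_triangles n m B. ?p u * ?p v * ?p w)"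
  proof (rule sum_mono, clarify)
    fix a b c u v w assume i: "((a, b, c), u, v, w) \<in> rainbow_triangles n m B"
    have "measure_pmf.prob Q {S. {a, b} \<subseteq> S u \<and> {a, c} \<subseteq> S v \<and> {b, c} \<subseteq> S w}
      = measure_pmf.prob (unif_subset m (x u)) {A. a \<in> A \<and> b \<in> A}
        * measure_pmf.prob (unif_subset m (x v)) {A. a \<in> A \<and> c \<in> A}
        * measure_pmf.prob (unif_subset m (x w)) {A. b \<in> A \<and> c \<in> A}"
      using prob_three_independent[of u v w "{A. a \<in> A \<and> b \<in> A}" "{A. a \<in> A \<and> c \<in> A}" "{A. b \<in> A \<and> c \<in> A}"] i
      by (simp add: rainbow_triangles_def)
    also have "\<dots> \<le> ?p u * ?p v * ?p w"
      using i by (intro mult_mono prob_unif_subset_mem2_le x_le) (auto simp: rainbow_triangles_def)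
    finally show "measure_pmf.prob Q {S. {a, b} \<subseteq> S u \<and> {a, c} \<subseteq> S v \<and> {b, c} \<subseteq> S w} \<le> ?p u * ?p v * ?p w" .
  qed
  also have "\<dots> \<le> (\<Sum>((a, b, c), u, v, w)\<in>?D. ?p u * ?p v * ?p w)"
    by (rule sum_mono2) (auto simp: rainbow_triangles_def)
  also have "\<dots> = (\<Sum>abc\<in>{..<m} \<times> {..<m} \<times> {..<m}.
      \<Sum>(u, v, w)\<in>{..<n} \<times> ({..<n} - B) \<times> ({..<n} - B). ?p u * ?p v * ?p w)"
    by (subst sum.cartesian_product) (simp add: case_prod_beta')
  also have "\<dots> = real m ^ 3 * ((\<Sum>u<n. ?p u) * (\<Sum>v\<in>{..<n} - B. ?p v) * (\<Sum>w\<in>{..<n} - B. ?p w))"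
    unfolding sum_triple_product by (simp add: card_cartesian_product power3_eq_cube)
  also have "\<dots> = (\<Sum>v<n. real (x v) ^ 2) * (\<Sum>v\<in>{..<n} - B. real (x v) ^ 2) ^ 2 / real m ^ 3"
    using m_pos
    by (simp add: power_divide sum_divide_distrib[symmetric] power2_eq_square power3_eq_cube)
  finally show ?thesis .
qed

text \<open>Given the set of \<open>u\<close>, the other sets remain independent, and the degree
  dominates a sum of independent [0,1]-valued variables of mean x u / m, to which the Chernoff bound
  applies.\<close>

lemma prob_degree_le:
  assumes u: "u < n" and J: "J \<subseteq> {..<n} - {u}" "\<And>v. v \<in> J \<Longrightarrow> 0 < x v"
  shows "measure_pmf.prob Q {S. real (rig_degree n S u) \<le> real (x u) / m * card J / 4}
           \<le> exp (- (real (x u) / m * card J / 4))"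
proof -
  let ?V = "{..<n} - {u}" and ?r = "real (x u) / m * card J / 4"
  let ?P = "Pi_pmf ?V {} (\<lambda>v. unif_subset m (x v))"
  have finJ: "finite J" using J finite_subset by blast
  have ins: "{..<n} = insert u ?V" using u by auto
  have Q: "Q = bind_pmf (unif_subset m (x u)) (\<lambda>A. map_pmf (\<lambda>f. f(u := A)) ?P)"
    unfolding Q_def by (subst ins, subst Pi_pmf_insert') (auto simp: map_pmf_def)
  have "measure_pmf.prob (map_pmf (\<lambda>f. f(u := A)) ?P) {S. real (rig_degree n S u) \<le> ?r} \<le> exp (- ?r)"
    if A: "A \<in> set_pmf (unif_subset m (x u))" for A
  proof -
    have A': "A \<subseteq> {..<m}" "card A = x u" "finite A"
      using A x_le[OF u] by (auto simp: set_unif_subset intro: finite_subset)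
    \<comment> \<open>The fraction of \<open>T\<close> that falls into \<open>A\<close> is a lower
      bound for the indicator that \<open>T\<close> meets \<open>A\<close>. Its mean does not depend
      on the size of \<open>T\<close>, and no probability of disjointness has to be computed.
      Division by \<open>x v\<close> is why \<open>J\<close> has only vertices of positive
      size.\<close>
    define f where "f v T = real (card (T \<inter> A)) / x v" for v and T :: "nat set"
    have supp: "T \<subseteq> {..<m}" "card T = x v" "finite T" if "v \<in> J" "T \<in> set_pmf (unif_subset m (x v))" for v T
      using that J x_le[of v] by (auto simp: set_unif_subset subset_eq finite_nat_iff_bounded)
    have f01: "0 \<le> f v T \<and> f v T \<le> 1" if "v \<in> J" "T \<in> set_pmf (unif_subset m (x v))" for v T
    proof -
      have "card (T \<inter> A) \<le> x v" using supp[OF that] card_mono[of T "T \<inter> A"] by auto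
      then show ?thesis using J(2)[OF that(1)] by (auto simp: f_def)
    qed
    have mean: "measure_pmf.expectation (unif_subset m (x v)) (f v) = real (x u) / m" if v: "v \<in> J" for v
    proof -
      have v': "x v \<le> m" "0 < x v" using J v x_le[of v] by auto
      have "f v = (\<lambda>T. \<Sum>a\<in>A. indicator {T. a \<in> T} T / x v)"
        using A'(3) by (intro ext) (simp add: f_def indicator_def sum_divide_distrib[symmetric] sum.If_cases Int_commute)
      then have "measure_pmf.expectation (unif_subset m (x v)) (f v)
        = (\<Sum>a\<in>A. measure_pmf.prob (unif_subset m (x v)) {T. a \<in> T} / x v)"
        by (simp only:, subst Bochner_Integration.integral_sum)
           (auto intro!: integrable_divide integrable_pmf_01[of _ "indicator _"])
      \<comment> \<open>Each attribute of \<open>A\<close> contributes its membership probability x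
        v / m divided by x v.\<close>
      also have "\<dots> = (\<Sum>a\<in>A. 1 / m)"
        using v' A' by (intro sum.cong refl) (auto simp: prob_unif_subset_mem subset_eq)
      also have "\<dots> = real (x u) / m" using A' by simp
      finally show ?thesis .
    qed
    have "measure_pmf.prob (map_pmf (\<lambda>f. f(u := A)) ?P) {S. real (rig_degree n S u) \<le> ?r}
       = measure_pmf.prob ?P {S. real (rig_degree n (S(u := A)) u) \<le> ?r}"
      by (simp add: vimage_def)
    also have "\<dots> \<le> measure_pmf.prob ?P {S. (\<Sum>v\<in>J. f v (S v)) \<le> ?r}"
    proof (rule prob_le_on_set_pmf)
      fix S assume S: "S \<in> set_pmf ?P" and le: "S \<in> {S. real (rig_degree n (S(u := A)) u) \<le> ?r}"
      have Sv: "S v \<in> set_pmf (unif_subset m (x v))" if "v \<in> J" for v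
        using S J that by (auto simp: set_Pi_pmf PiE_dflt_def)
      have "(\<Sum>v\<in>J. f v (S v)) \<le> (\<Sum>v\<in>J. if A \<inter> S v \<noteq> {} then 1 else 0)"
      proof (rule sum_mono)
        fix v assume "v \<in> J"
        then show "f v (S v) \<le> (if A \<inter> S v \<noteq> {} then 1 else 0)"
          using f01[OF _ Sv, of v] by (cases "A \<inter> S v = {}") (auto simp: f_def Int_commute)
      qed
      also have "\<dots> = real (card {v \<in> J. A \<inter> S v \<noteq> {}})"
        using finJ by (simp add: sum.If_cases Int_def)
      also have "\<dots> \<le> real (rig_degree n (S(u := A)) u)"
        unfolding rig_degree_def using J by (intro of_nat_mono card_mono) (auto simp: rig_edge_def)
      finally show "S \<in> {S. (\<Sum>v\<in>J. f v (S v)) \<le> ?r}" using le by simp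
    qed
    also have "\<dots> \<le> exp (- ?r)"
      by (rule prob_sum_Pi_pmf_le) (use J f01 mean in auto)
    finally show ?thesis .
  qed
  then have "measure_pmf.prob Q {S. real (rig_degree n S u) \<le> ?r}
      \<le> measure_pmf.prob (unif_subset m (x u)) {} + exp (- ?r)"
    unfolding Q by (intro prob_bind_pmf_le) auto
  then show ?thesis by simp
qed

text \<open>The second alternative puts every vertex of bounded size into the exceptional case, so
  that outside it the degree is at least 2 and \<open>choose_two_ge\<close> applies.\<close>

definition low_degree :: "real \<Rightarrow> nat \<Rightarrow> (nat \<Rightarrow> nat set) set" where
  "low_degree c u = {S. real (rig_degree n S u) < c * x u \<or> c * x u < 2}"

text \<open>If c x u < 2, bounding the probability by 1 suffices. Otherwise \<open>J\<close> is
  large enough for the degree threshold to reach c x u, and exp(-y) <= 1/y turns the exponential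
  bound into the required order 1 / x u.\<close>

lemma prob_low_degree_le:
  fixes c :: real
  assumes u: "u < n" and c: "0 < c"
    and J: "J \<subseteq> {..<n} - {u}" "\<And>v. v \<in> J \<Longrightarrow> 0 < x v" "4 * c * m \<le> card J"
  shows "real (x u) * measure_pmf.prob Q (low_degree c u) \<le> 2 / c"
proof (cases "c * x u < 2")
  case True
  have "real (x u) * measure_pmf.prob Q (low_degree c u) \<le> real (x u) * 1"
    by (intro mult_left_mono) auto
  also have "\<dots> \<le> 2 / c" using True c by (simp add: field_simps)
  finally show ?thesis .
next
  case False
  then have x: "0 < x u" using c by (cases "x u = 0") auto
  have r: "c * x u \<le> real (x u) / m * card J / 4"
  proof -
    have "real (x u) * (4 * c * m) \<le> real (x u) * card J" using J(3) by (intro mult_left_mono) auto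
    then show ?thesis using m_pos by (simp add: field_simps)
  qed
  have "measure_pmf.prob Q (low_degree c u) \<le> measure_pmf.prob Q {S. real (rig_degree n S u) \<le> real (x u) / m * card J / 4}"
    using r False by (intro measure_pmf.finite_measure_mono) (auto simp: low_degree_def)
  also have "\<dots> \<le> exp (- (real (x u) / m * card J / 4))"
    by (rule prob_degree_le) (use u J in auto)
  also have "\<dots> \<le> exp (- (c * x u))" using r by simp
  also have "\<dots> = 1 / exp (c * x u)" by (simp add: exp_minus inverse_eq_divide)
  also have "\<dots> \<le> 1 / (c * x u)"
    using c x exp_ge_add_one_self[of "c * x u"] by (intro divide_left_mono mult_pos_pos) (linarith | simp)+
  finally have "real (x u) * measure_pmf.prob Q (low_degree c u) \<le> real (x u) * (1 / (c * x u))"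
    by (intro mult_left_mono) auto
  also have "\<dots> \<le> 2 / c" using c x by (simp add: field_simps)
  finally show ?thesis .
qed

text \<open>All smallness is carried by \<open>\<eta>\<close>. Three events are excluded: a big
  vertex of low degree, at least half of \<open>L\<close> lost to low-degree vertices, and too many
  monochrome or rainbow triangles. They account for the terms with 2/c, 4K/c and 48; outside them
  the coefficient is at most \<open>\<epsilon>\<close> deterministically.\<close>

lemma prob_clustering_coeff_le:
  fixes b K c \<eta> \<epsilon> :: real
  assumes n: "0 < n" and pos: "0 < c" "0 < K" "0 < \<eta>" "\<eta> \<le> 1" "0 < \<epsilon>"
    and ratio: "real n \<le> b * m"
    and sum_x: "(\<Sum>v<n. real (x v)) \<le> K * n"
    and sum_x2: "real n \<le> \<eta> * (\<Sum>v<n. real (x v) ^ 2)"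
    and card_big: "real (card big) \<le> \<eta> * sqrt m"
    and sum_small: "(\<Sum>v\<in>{..<n} - big. real (x v) ^ 2) \<le> \<eta> * (m * sqrt m)"
    and active: "\<And>u. u < n \<Longrightarrow> 4 * c * m \<le> card {v \<in> {..<n} - {u}. 0 < x v}"
    and small: "24 * \<eta> \<le> \<epsilon> * c"
  shows "measure_pmf.prob Q {S. \<epsilon> < \<bar>clustering_coeff {..<n} (rig_edge S)\<bar>}
     \<le> (4 * K / c + 2 / c + 48 * (K ^ 3 * b\<^sup>2 + 1) / (\<epsilon> * c\<^sup>2)) * \<eta>"
proof -
  define L where "L = (\<Sum>v<n. real (x v) ^ 2)"
  have L: "0 < L" "real n \<le> \<eta> * L" using n pos sum_x2 zero_less_mult_pos[of \<eta> L]
    by (auto simp: L_def)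
  have low: "real (x u) * measure_pmf.prob Q (low_degree c u) \<le> 2 / c" if "u < n" for u
    by (rule prob_low_degree_le[OF that pos(1) _ _ active[OF that]]) auto
  define lost where "lost S = (\<Sum>u<n. real (x u) ^ 2 * indicator (low_degree c u) S)" for S
  have lost_nonneg: "0 \<le> lost S" for S by (auto simp: lost_def intro!: sum_nonneg)
  define T where "T S = real (num_monochrome n m S) + real (num_rainbow n m big S)" for S
  have T_nonneg: "0 \<le> T S" for S by (simp add: T_def)
  \<comment> \<open>Union bound: at most \<open>\<eta>\<close> sqrt m big vertices, each failing
    with probability at most 2 / (c sqrt m).\<close>
  have P1: "measure_pmf.prob Q (\<Union>u\<in>big. low_degree c u) \<le> 2 / c * \<eta>"
  proof -
    have "measure_pmf.prob Q (low_degree c u) \<le> 2 / (c * sqrt m)" if "u \<in> big" for u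
    proof -
      have u: "u < n" "real m < real (x u) ^ 2"
        using that by (auto simp: big_def simp flip: of_nat_power)
      then have s: "sqrt m \<le> x u" by (intro real_le_lsqrt) auto
      have "sqrt m * measure_pmf.prob Q (low_degree c u) \<le> x u * measure_pmf.prob Q (low_degree c u)"
        by (rule mult_right_mono[OF s]) simp
      also have "\<dots> \<le> 2 / c" by (rule low[OF u(1)])
      finally show ?thesis using m_pos pos by (simp add: field_simps)
    qed
    then have "(\<Sum>u\<in>big. measure_pmf.prob Q (low_degree c u)) \<le> (\<Sum>u\<in>big. 2 / (c * sqrt m))"
      by (intro sum_mono)
    moreover have "measure_pmf.prob Q (\<Union>u\<in>big. low_degree c u) \<le> (\<Sum>u\<in>big. measure_pmf.prob Q (low_degree c u))"
      by (rule measure_pmf.finite_measure_subadditive_finite) (auto simp: big_def)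
    moreover have "(\<Sum>u\<in>big. 2 / (c * sqrt m)) = card big * (2 / (c * sqrt m))" by simp
    moreover have "card big * (2 / (c * sqrt m)) \<le> (\<eta> * sqrt m) * (2 / (c * sqrt m))"
      using pos card_big by (intro mult_right_mono) auto
    moreover have "(\<eta> * sqrt m) * (2 / (c * sqrt m)) = 2 / c * \<eta>" using m_pos by simp
    ultimately show ?thesis by linarith
  qed
  \<comment> \<open>The weight x^2 times a failure probability of order 1/x leaves the first moment,
    at most K n, and \<open>sum_x2\<close> bounds n by \<open>\<eta> * L\<close>.\<close>
  have P2: "measure_pmf.prob Q {S. L / 2 \<le> lost S} \<le> 4 * K / c * \<eta>"
  proof -
    have "measure_pmf.expectation Q lost = (\<Sum>u<n. real (x u) ^ 2 * measure_pmf.prob Q (low_degree c u))"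
      unfolding lost_def by (subst Bochner_Integration.integral_sum) auto
    also have "\<dots> \<le> (\<Sum>u<n. real (x u) * (2 / c))"
    proof (rule sum_mono)
      fix u assume "u \<in> {..<n}"
      then show "real (x u) ^ 2 * measure_pmf.prob Q (low_degree c u) \<le> real (x u) * (2 / c)"
        using mult_left_mono[OF low[of u], of "real (x u)"] by (simp add: power2_eq_square mult.assoc)
    qed
    also have "\<dots> = (\<Sum>u<n. real (x u)) * (2 / c)" by (rule sum_distrib_right[symmetric])
    also have "\<dots> \<le> (K * (\<eta> * L)) * (2 / c)"
      using pos order_trans[OF sum_x mult_left_mono[OF L(2), of K]] by (intro mult_right_mono) auto
    finally have "measure_pmf.prob Q {S. L / 2 \<le> lost S} \<le> (K * (\<eta> * L)) * (2 / c) / (L / 2)"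
      using L lost_nonneg by (intro markov_pmf) auto
    also have "\<dots> = 4 * K / c * \<eta>" using L by simp
    finally show ?thesis .
  qed
  \<comment> \<open>The constant 48 = 3 * 2 * 8 is chosen so that three times \<open>T S\<close>
    stays below half of \<open>\<epsilon>\<close> times the lower bound c^2/8 * L for the number of
    2-paths.\<close>
  have P3: "measure_pmf.prob Q {S. \<epsilon> * c\<^sup>2 / 48 * L \<le> T S} \<le> 48 * (K ^ 3 * b\<^sup>2 + 1) / (\<epsilon> * c\<^sup>2) * \<eta>"
  proof -
    have b: "0 < b" using ratio n m_pos zero_less_mult_pos2[of b m] by auto
    have mono: "measure_pmf.expectation Q (\<lambda>S. real (num_monochrome n m S)) \<le> K ^ 3 * b\<^sup>2 * (\<eta> * L)"
    proof -
      have "measure_pmf.expectation Q (\<lambda>S. real (num_monochrome n m S)) \<le> (K * n) ^ 3 / real m ^ 2"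
        by (rule order_trans[OF expectation_num_monochrome_le])
           (use sum_x in \<open>auto intro!: divide_right_mono power_mono sum_nonneg\<close>)
      also have "\<dots> = K ^ 3 * n * (n / m)\<^sup>2"
        by (simp add: power2_eq_square power3_eq_cube)
      also have "\<dots> \<le> K ^ 3 * n * b\<^sup>2"
        using ratio m_pos pos by (intro mult_left_mono power_mono) (auto simp: field_simps)
      also have "\<dots> = K ^ 3 * b\<^sup>2 * n" by simp
      also have "\<dots> \<le> K ^ 3 * b\<^sup>2 * (\<eta> * L)"
        using L pos by (intro mult_left_mono) auto
      finally show ?thesis .
    qed
    have rainbow: "measure_pmf.expectation Q (\<lambda>S. real (num_rainbow n m big S)) \<le> \<eta> * L"
    proof -
      have "measure_pmf.expectation Q (\<lambda>S. real (num_rainbow n m big S)) \<le> L * (\<eta> * (m * sqrt m)) ^ 2 / real m ^ 3"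
        by (rule order_trans[OF expectation_num_rainbow_le])
           (use sum_small L in \<open>auto intro!: divide_right_mono mult_left_mono power_mono sum_nonneg simp flip: L_def\<close>)
      also have "\<dots> = L * (\<eta> * \<eta>)"
        using m_pos by (simp add: power_mult_distrib) (simp add: power2_eq_square power3_eq_cube)
      \<comment> \<open>Here \<open>\<eta> \<le> 1\<close> is used to give up one factor.\<close>
      also have "\<dots> \<le> L * \<eta>" using L pos by (simp add: mult_left_le)
      finally show ?thesis by (simp add: mult.commute)
    qed
    have "measure_pmf.expectation Q T \<le> (K ^ 3 * b\<^sup>2 + 1) * (\<eta> * L)"
      using mono rainbow unfolding T_def by (simp add: distrib_right)
    then have "measure_pmf.prob Q {S. \<epsilon> * c\<^sup>2 / 48 * L \<le> T S} \<le> (K ^ 3 * b\<^sup>2 + 1) * (\<eta> * L) / (\<epsilon> * c\<^sup>2 / 48 * L)"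
      using L pos T_nonneg by (intro markov_pmf) auto
    also have "\<dots> = 48 * (K ^ 3 * b\<^sup>2 + 1) / (\<epsilon> * c\<^sup>2) * \<eta>" using L by simp
    finally show ?thesis .
  qed
  have "measure_pmf.prob Q {S. \<epsilon> < \<bar>clustering_coeff {..<n} (rig_edge S)\<bar>}
     \<le> measure_pmf.prob Q ((\<Union>u\<in>big. low_degree c u) \<union> {S. L / 2 \<le> lost S} \<union> {S. \<epsilon> * c\<^sup>2 / 48 * L \<le> T S})"
  proof (rule prob_le_on_set_pmf, rule ccontr)
    fix S assume SQ: "S \<in> set_pmf Q" and C: "S \<in> {S. \<epsilon> < \<bar>clustering_coeff {..<n} (rig_edge S)\<bar>}"
      and notin: "S \<notin> (\<Union>u\<in>big. low_degree c u) \<union> {S. L / 2 \<le> lost S} \<union> {S. \<epsilon> * c\<^sup>2 / 48 * L \<le> T S}"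
    define d where "d u = real (rig_degree n S u)" for u
    define ch where "ch u = real (rig_degree n S u choose 2)" for u
    define \<Lambda> where "\<Lambda> = real (num_paths2 {..<n} (rig_edge S))"
    have \<Lambda>: "\<Lambda> = (\<Sum>u<n. ch u)" by (simp add: \<Lambda>_def ch_def num_paths2_eq_sum_degrees)
    have good: "c * x u \<le> d u" "2 \<le> c * x u" "d u * d u / 4 \<le> ch u" if "S \<notin> low_degree c u" for u
    proof -
      show 1: "c * x u \<le> d u" "2 \<le> c * x u" using that by (auto simp: low_degree_def d_def)
      then show "d u * d u / 4 \<le> ch u" unfolding d_def ch_def by (intro choose_two_ge) linarith
    qed
    \<comment> \<open>The factor with the indicator makes the bound trivial for low-degree vertices,
      so it can be summed over all vertices.\<close>
    have low1: "c\<^sup>2 / 4 * (real (x u) ^ 2 * (1 - indicator (low_degree c u) S)) \<le> ch u" for u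
    proof (cases "S \<in> low_degree c u")
      case False
      then have "(c * x u) * (c * x u) \<le> d u * d u"
        using good[of u] by (intro mult_mono) auto
      then show ?thesis using good(3)[OF False] False by (simp add: power2_eq_square algebra_simps)
    qed (simp add: ch_def)
    have "c\<^sup>2 / 8 * L \<le> c\<^sup>2 / 4 * (L - lost S)" 
    proof -
      have "c\<^sup>2 / 4 * (L / 2) \<le> c\<^sup>2 / 4 * (L - lost S)" using notin by (intro mult_left_mono) auto
      then show ?thesis by simp
    qed
    also have "\<dots> = (\<Sum>u<n. c\<^sup>2 / 4 * (real (x u) ^ 2 * (1 - indicator (low_degree c u) S)))"
      unfolding L_def lost_def sum_subtractf[symmetric] sum_distrib_left
      by (intro sum.cong) (simp_all add: right_diff_distrib)
    also have "\<dots> \<le> \<Lambda>" unfolding \<Lambda> by (intro sum_mono low1)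
    finally have \<Lambda>L: "c\<^sup>2 / 8 * L \<le> \<Lambda>" .
    then have \<Lambda>pos: "0 < \<Lambda>" using L pos by (smt (verit) divide_pos_pos mult_pos_pos zero_less_power)
    \<comment> \<open>For a big \<open>u\<close>, the number of big vertices is at most
      \<open>\<eta>\<close> sqrt m <= \<open>\<eta>\<close> x u, while d u >= c x u. With 24
      \<open>\<eta>\<close> <= \<open>\<epsilon>\<close> c this gives 3 |big| d u <=
      (\<open>\<epsilon>\<close>/2) (d u)^2 / 4.\<close>
    have two_big: "3 * (card big * (\<Sum>u\<in>big. d u)) \<le> \<epsilon> / 2 * \<Lambda>"
    proof -
      have "3 * (card big * d u) \<le> \<epsilon> / 2 * ch u" if "u \<in> big" for u
      proof -
        have u: "S \<notin> low_degree c u" using notin that by auto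
        have "real m < real (x u) ^ 2"
          using that by (auto simp: big_def simp flip: of_nat_power)
        then have s: "sqrt m \<le> x u" by (intro real_le_lsqrt) auto
        have "24 * real (card big) \<le> 24 * \<eta> * sqrt m" using card_big by simp
        also have "\<dots> \<le> \<epsilon> * c * x u" using small s pos by (intro mult_mono[of "24 * \<eta>"]) auto
        also have "\<dots> \<le> \<epsilon> * d u" using good(1)[OF u] pos by simp
        finally have "24 * real (card big) * d u \<le> \<epsilon> * d u * d u"
          by (intro mult_right_mono) (auto simp: d_def)
        moreover have "\<epsilon> * (d u * d u / 4) \<le> \<epsilon> * ch u" using good(3)[OF u] pos by simp
        ultimately show ?thesis by simp
      qed
      then have "(\<Sum>u\<in>big. 3 * (card big * d u)) \<le> (\<Sum>u\<in>big. \<epsilon> / 2 * ch u)"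
        by (intro sum_mono)
      also have "\<dots> \<le> (\<Sum>u<n. \<epsilon> / 2 * ch u)"
        using pos by (intro sum_mono2) (auto simp: big_def ch_def)
      finally show ?thesis by (simp add: \<Lambda> sum_distrib_left)
    qed
    have "real (num_triangles {..<n} (rig_edge S))
       \<le> real (card big * (\<Sum>u\<in>big. rig_degree n S u) + num_monochrome n m S + num_rainbow n m big S)"
      using set_Q[OF SQ] by (intro of_nat_mono num_triangles_le) (auto simp: big_def)
    also have "\<dots> = card big * (\<Sum>u\<in>big. d u) + T S" by (simp add: T_def d_def)
    finally have "3 * real (num_triangles {..<n} (rig_edge S)) \<le> \<epsilon> / 2 * \<Lambda> + 3 * T S"
      using two_big by simp
    also have "3 * T S \<le> \<epsilon> / 2 * (c\<^sup>2 / 8 * L)" using notin by (simp add: field_simps)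
    also have "\<dots> \<le> \<epsilon> / 2 * \<Lambda>" using \<Lambda>L pos by (intro mult_left_mono) auto
    finally have "3 * real (num_triangles {..<n} (rig_edge S)) / \<Lambda> \<le> \<epsilon>"
      using \<Lambda>pos by (simp add: field_simps)
    then show False using C by (simp add: clustering_coeff_def \<Lambda>_def)
  qed
  also have "\<dots> \<le> 2 / c * \<eta> + 4 * K / c * \<eta> + 48 * (K ^ 3 * b\<^sup>2 + 1) / (\<epsilon> * c\<^sup>2) * \<eta>"
    using P1 P2 P3 by (intro order_trans[OF measure_Un_le] add_mono) auto
  finally show ?thesis by (simp add: algebra_simps)
qed

end

section \<open>Random sizes: typical behaviour of independent copies of Z\<close>

text \<open>A product of two-stage distributions may be sampled stage by stage: first all sizes,
  then all sets given the sizes.\<close>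

lemma active_rig_eq_bind:
  assumes "0 < m"
  shows "active_rig n m (map_pmf (\<lambda>z. min z m) Z)
     = bind_pmf (Pi_pmf {..<n} 0 (\<lambda>_. Z)) (\<lambda>z. sized_rig.Q n m (\<lambda>v. min (z v) m))"
proof -
  have "sized_rig n m (\<lambda>v. min (z v) m)" for z :: "nat \<Rightarrow> nat"
    using assms by unfold_locales auto
  then show ?thesis
    by (simp add: active_rig_def attr_pmf_def bind_map_pmf unif_subset_def[symmetric] sized_rig.Q_def
        Pi_pmf_bind[where d' = 0])
qed

lemma markov_iid:
  fixes h :: "nat \<Rightarrow> real" and n :: nat
  assumes "integrable (measure_pmf Z) h" "\<And>z. 0 \<le> h z" "0 < t"
  shows "measure_pmf.prob (Pi_pmf {..<n} 0 (\<lambda>_. Z)) {z. t \<le> (\<Sum>v<n. h (z v))}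
           \<le> n * measure_pmf.expectation Z h / t"
  by (rule markov_pmf) (use assms in \<open>auto intro!: integrable_sum_Pi_pmf sum_nonneg simp: expectation_sum_Pi_pmf\<close>)

text \<open>An upper bound for sqrt m times the probability that Z exceeds sqrt m; it controls the
  number of big vertices.\<close>

definition tail_mean :: "nat pmf \<Rightarrow> nat \<Rightarrow> real" where
  "tail_mean Z m = measure_pmf.expectation Z (\<lambda>z. if m < z\<^sup>2 then real z else 0)"

text \<open>Dividing by sqrt m makes the integrand at most \<open>z\<close>, so that integrability
  of Z suffices for dominated convergence.\<close>

definition trunc_sq_mean :: "nat pmf \<Rightarrow> nat \<Rightarrow> real" where
  "trunc_sq_mean Z m = measure_pmf.expectation Z (\<lambda>z. if z\<^sup>2 \<le> m then real z ^ 2 / sqrt m else 0)"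

lemma trunc_sq_le: "z\<^sup>2 \<le> m \<Longrightarrow> real z ^ 2 / sqrt (real m) \<le> real z"
proof -
  assume "z\<^sup>2 \<le> m"
  then have "real z ^ 2 \<le> real m" by (simp flip: of_nat_power)
  then have "real z \<le> sqrt m" by (rule real_le_rsqrt)
  then have "real z * real z \<le> real z * sqrt m" by (intro mult_left_mono) auto
  then show ?thesis by (cases "m = 0") (auto simp: field_simps power2_eq_square)
qed

text \<open>Dominated convergence: for each fixed \<open>z\<close> the integrand vanishes once m >=
  z^2.\<close>

lemma tail_mean_tendsto_0:
  assumes "integrable (measure_pmf Z) real"
  shows "tail_mean Z \<longlonglongrightarrow> 0"
proof -
  have "(\<lambda>m. tail_mean Z m) \<longlonglongrightarrow> measure_pmf.expectation Z (\<lambda>z. 0)"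
    unfolding tail_mean_def
  proof (rule integral_dominated_convergence[where w = real])
    show "AE z in measure_pmf Z. (\<lambda>m. if m < z\<^sup>2 then real z else 0) \<longlonglongrightarrow> 0"
    proof (rule AE_pmfI)
      fix z
      show "(\<lambda>m. if m < z\<^sup>2 then real z else 0) \<longlonglongrightarrow> 0"
        by (intro tendsto_eventually eventually_sequentiallyI[of "z\<^sup>2"]) auto
    qed
  qed (use assms in auto)
  then show ?thesis by simp
qed

lemma trunc_sq_mean_tendsto_0:
  assumes "integrable (measure_pmf Z) real"
  shows "trunc_sq_mean Z \<longlonglongrightarrow> 0"
proof -
  have "(\<lambda>m. trunc_sq_mean Z m) \<longlonglongrightarrow> measure_pmf.expectation Z (\<lambda>z. 0)"
    unfolding trunc_sq_mean_def
  proof (rule integral_dominated_convergence[where w = real])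
    show "AE z in measure_pmf Z. (\<lambda>m. if z\<^sup>2 \<le> m then real z ^ 2 / sqrt m else 0) \<longlonglongrightarrow> 0"
    proof (rule AE_pmfI)
      fix z
      have "(\<lambda>m::nat. real z ^ 2 / sqrt m) \<longlonglongrightarrow> 0"
        by (intro tendsto_divide_0[OF tendsto_const] filterlim_at_top_imp_at_infinity
            filterlim_compose[OF sqrt_at_top] filterlim_real_sequentially)
      then show "(\<lambda>m. if z\<^sup>2 \<le> m then real z ^ 2 / sqrt m else 0) \<longlonglongrightarrow> 0"
        by (rule Lim_transform_eventually) (intro eventually_sequentiallyI[of "z\<^sup>2"], auto)
    qed
    show "AE z in measure_pmf Z. norm (if z\<^sup>2 \<le> m then real z ^ 2 / sqrt m else 0) \<le> real z" for m
      using trunc_sq_le by (auto intro!: AE_pmfI)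
  qed (use assms in auto)
  then show ?thesis by simp
qed

text \<open>The sets \<open>B1\<close> to \<open>B5\<close> collect the sizes violating one of the
  size conditions of \<open>prob_clustering_coeff_le\<close>. Markov's inequality handles
  \<open>B1\<close>, \<open>B4\<close> and \<open>B5\<close>, and the Chernoff bound handles
  \<open>B2\<close> and \<open>B3\<close>.\<close>

lemma prob_active_rig_clustering_le:
  fixes b K p c \<eta> \<epsilon> :: real and Z :: "nat pmf"
  defines "p \<equiv> measure_pmf.prob Z {z. 0 < z}" and "c \<equiv> p / (32 * b)"
  assumes Z: "integrable (measure_pmf Z) real"
    and p: "0 < p" and pos: "0 < b" "0 < K" "0 < \<eta>" "\<eta> \<le> 1" "0 < \<epsilon>" "24 * \<eta> \<le> \<epsilon> * c"
    and t: "0 < t" "4 / \<eta> \<le> measure_pmf.expectation Z (\<lambda>z. real (min z t) ^ 2)"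
    and nm: "2 \<le> m" "t \<le> m" "8 / p \<le> n" "real n \<le> b * m" "real m \<le> b * n"
  shows "measure_pmf.prob (active_rig n m (map_pmf (\<lambda>z. min z m) Z))
            {S. \<epsilon> < \<bar>clustering_coeff {..<n} (rig_edge S)\<bar>}
     \<le> measure_pmf.expectation Z real / K + exp (- (1 / (\<eta> * real t ^ 2) * n))
       + exp (- (p / 4 * n)) + b / \<eta> * tail_mean Z m + b / \<eta> * trunc_sq_mean Z m
       + (4 * K / c + 2 / c + 48 * (K ^ 3 * b\<^sup>2 + 1) / (\<epsilon> * c\<^sup>2)) * \<eta>"
proof -
  let ?P = "Pi_pmf {..<n} 0 (\<lambda>_. Z)"
  define A where "A = 4 * K / c + 2 / c + 48 * (K ^ 3 * b\<^sup>2 + 1) / (\<epsilon> * c\<^sup>2)"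
  define \<mu> where "\<mu> = measure_pmf.expectation Z real"
  have c: "0 < c" using p pos by (simp add: c_def)
  have A0: "0 \<le> A" using c pos by (simp add: A_def)
  have n: "0 < n" using nm(3) p by (cases n) (auto simp: field_simps)
  have m: "0 < m" "0 < real m" using nm by auto
  define B1 where "B1 = {z. K * n \<le> (\<Sum>v<n. real (z v))}"
  \<comment> \<open>Division by t^2 brings the truncated squares into [0,1]. Their mean is at least
    4 / (\<open>\<eta>\<close> t^2), so a quarter of the expected sum already forces the truncated
    squares to add up to n / \<open>\<eta>\<close>.\<close>
  define B2 where "B2 = {z. (\<Sum>v<n. real (min (z v) t) ^ 2 / real t ^ 2) \<le> 4 / (\<eta> * real t ^ 2) * card {..<n} / 4}"
  define B3 where "B3 = {z :: nat \<Rightarrow> nat. (\<Sum>v<n. indicator {z. 0 < z} (z v)) \<le> p * card {..<n} / 4}"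
  define B4 where "B4 = {z :: nat \<Rightarrow> nat. \<eta> * sqrt m \<le> (\<Sum>v<n. if m < (z v)\<^sup>2 then 1 else 0)}"
  define B5 where "B5 = {z. \<eta> * m \<le> (\<Sum>v<n. if (z v)\<^sup>2 \<le> m then real (z v) ^ 2 / sqrt m else 0)}"
  have P1: "measure_pmf.prob ?P B1 \<le> \<mu> / K"
  proof -
    have "measure_pmf.prob ?P B1 \<le> n * \<mu> / (K * n)"
      unfolding B1_def \<mu>_def using n pos Z by (intro markov_iid) auto
    then show ?thesis using n by simp
  qed
  have P2: "measure_pmf.prob ?P B2 \<le> exp (- (1 / (\<eta> * real t ^ 2) * n))"
  proof -
    have "measure_pmf.prob ?P B2 \<le> exp (- (4 / (\<eta> * real t ^ 2) * card {..<n} / 4))"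
      unfolding B2_def
    proof (rule prob_sum_Pi_pmf_le)
      fix v
      show "4 / (\<eta> * real t ^ 2) \<le> measure_pmf.expectation Z (\<lambda>z. real (min z t) ^ 2 / real t ^ 2)"
        using t pos divide_right_mono[OF t(2), of "real t ^ 2"] by (simp add: field_simps)
      fix z
      have "real (min z t) ^ 2 \<le> real t ^ 2" by (intro power_mono) auto
      then show "0 \<le> real (min z t) ^ 2 / real t ^ 2 \<and> real (min z t) ^ 2 / real t ^ 2 \<le> 1"
        using t by simp
    qed auto
    then show ?thesis by simp
  qed
  have P3: "measure_pmf.prob ?P B3 \<le> exp (- (p / 4 * n))"
  proof -
    have "measure_pmf.prob ?P B3 \<le> exp (- (p * card {..<n} / 4))"
      unfolding B3_def by (rule prob_sum_Pi_pmf_le) (auto simp: p_def)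
    then show ?thesis by simp
  qed
  have P4: "measure_pmf.prob ?P B4 \<le> b / \<eta> * tail_mean Z m"
  proof -
    have "measure_pmf.prob ?P B4 \<le> n * measure_pmf.expectation Z (\<lambda>z. if m < z\<^sup>2 then 1 else 0) / (\<eta> * sqrt m)"
      unfolding B4_def using pos m
      by (intro markov_iid[where h = "\<lambda>z. if m < z\<^sup>2 then 1 else 0"]) (auto intro!: integrable_pmf_01)
    \<comment> \<open>On the tail z / sqrt m is at least 1, which gives one factor 1 / sqrt m;
      Markov's inequality at \<open>\<eta>\<close> sqrt m gives the other, and together they cancel
      m.\<close>
    also have "\<dots> \<le> (b * m) * (tail_mean Z m / sqrt m) / (\<eta> * sqrt m)"
    proof (intro divide_right_mono mult_mono nm)
      have "measure_pmf.expectation Z (\<lambda>z. if m < z\<^sup>2 then 1 else 0)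
          \<le> measure_pmf.expectation Z (\<lambda>z. (if m < z\<^sup>2 then real z else 0) / sqrt m)"
      proof (rule integral_mono)
        show "integrable (measure_pmf Z) (\<lambda>z. if m < z\<^sup>2 then 1 else 0 :: real)"
          by (rule integrable_pmf_01) auto
        show "integrable (measure_pmf Z) (\<lambda>z. (if m < z\<^sup>2 then real z else 0) / sqrt m)"
          by (intro integrable_divide Bochner_Integration.integrable_bound[OF Z]) auto
        fix z
        have "sqrt m \<le> real z" if "m < z\<^sup>2"
          using that by (intro real_le_lsqrt) (auto simp flip: of_nat_power)
        then show "(if m < z\<^sup>2 then 1 else 0) \<le> (if m < z\<^sup>2 then real z else 0) / sqrt m"
          using m by (auto simp: field_simps)
      qed
      then show "measure_pmf.expectation Z (\<lambda>z. if m < z\<^sup>2 then 1 else 0) \<le> tail_mean Z m / sqrt m"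
        by (simp add: tail_mean_def)
    qed (use pos in \<open>auto intro!: integral_nonneg_AE\<close>)
    also have "\<dots> = b / \<eta> * tail_mean Z m * (m / (sqrt m * sqrt m))"
      by (simp only: times_divide_eq_left times_divide_eq_right divide_divide_eq_left mult_ac)
    also have "\<dots> = b / \<eta> * tail_mean Z m" using m by (simp del: times_divide_eq_right)
    finally show ?thesis .
  qed
  have P5: "measure_pmf.prob ?P B5 \<le> b / \<eta> * trunc_sq_mean Z m"
  proof -
    have tm: "0 \<le> trunc_sq_mean Z m"
      unfolding trunc_sq_mean_def by (rule integral_nonneg_AE) auto
    have "measure_pmf.prob ?P B5 \<le> n * trunc_sq_mean Z m / (\<eta> * m)"
      unfolding B5_def trunc_sq_mean_def using pos m trunc_sq_le
      by (intro markov_iid[where h = "\<lambda>z. if z\<^sup>2 \<le> m then real z ^ 2 / sqrt m else 0"])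
         (auto intro!: Bochner_Integration.integrable_bound[OF Z])
    also have "\<dots> \<le> (b * m) * trunc_sq_mean Z m / (\<eta> * m)"
      using nm pos tm by (intro divide_right_mono mult_mono) auto
    also have "\<dots> = b / \<eta> * trunc_sq_mean Z m" using m by simp
    finally show ?thesis .
  qed
  have main: "measure_pmf.prob (sized_rig.Q n m (\<lambda>v. min (z v) m))
      {S. \<epsilon> < \<bar>clustering_coeff {..<n} (rig_edge S)\<bar>} \<le> A * \<eta>" if z: "z \<notin> B1 \<union> B2 \<union> B3 \<union> B4 \<union> B5" for z
  proof -
    let ?x = "\<lambda>v. min (z v) m"
    interpret sized_rig n m ?x using m by unfold_locales auto
    \<comment> \<open>Capping at \<open>m\<close> does not change which vertices are big: m >= 2
      gives m < m^2, so a capped value is still big.\<close>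
    have big_iff: "m < (min y m)\<^sup>2 \<longleftrightarrow> m < y\<^sup>2" for y
    proof (cases "y \<le> m")
      case False
      have "m * 1 < m * m" "m * m \<le> y * y"
        using False nm by (auto intro!: mult_strict_left_mono mult_mono)
      then have "m < m * m" "m < y * y" by linarith+
      then show ?thesis using False by (simp add: power2_eq_square min_def)
    qed (simp add: min_def)
    show ?thesis unfolding A_def
    proof (rule prob_clustering_coeff_le)
      show "(\<Sum>v<n. real (?x v)) \<le> K * n"
      proof -
        have "(\<Sum>v<n. real (?x v)) \<le> (\<Sum>v<n. real (z v))" by (intro sum_mono) auto
        also have "\<dots> \<le> K * n" using z by (simp add: B1_def)
        finally show ?thesis .
      qed
      show "real n \<le> \<eta> * (\<Sum>v<n. real (?x v) ^ 2)"
      proof -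
        have "1 / (\<eta> * real t ^ 2) * n \<le> (\<Sum>v<n. real (min (z v) t) ^ 2 / real t ^ 2)"
          using z by (simp add: B2_def)
        then have "real n \<le> \<eta> * (\<Sum>v<n. real (min (z v) t) ^ 2)"
          using t pos by (simp add: sum_divide_distrib[symmetric] field_simps)
        also have "\<dots> \<le> \<eta> * (\<Sum>v<n. real (?x v) ^ 2)"
          using nm pos by (intro mult_left_mono sum_mono power_mono) auto
        finally show ?thesis .
      qed
      show "real (card big) \<le> \<eta> * sqrt m"
      proof -
        have "real (card big) = (\<Sum>v<n. if m < (z v)\<^sup>2 then 1 else 0)"
          by (simp add: big_def big_iff sum.If_cases Int_def)
        then show ?thesis using z by (simp add: B4_def)
      qed
      show "(\<Sum>v\<in>{..<n} - big. real (?x v) ^ 2) \<le> \<eta> * (m * sqrt m)"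
      proof -
        have "(\<Sum>v\<in>{..<n} - big. real (?x v) ^ 2) \<le> (\<Sum>v\<in>{..<n} - big. real (z v) ^ 2)"
          by (intro sum_mono power_mono) auto
        also have "\<dots> = (\<Sum>v<n. if (z v)\<^sup>2 \<le> m then real (z v) ^ 2 else 0)"
          by (intro sum.mono_neutral_cong_left) (auto simp: big_def big_iff)
        also have "\<dots> = sqrt m * (\<Sum>v<n. if (z v)\<^sup>2 \<le> m then real (z v) ^ 2 / sqrt m else 0)"
          unfolding sum_distrib_left using m by (intro sum.cong) auto
        also have "\<dots> \<le> sqrt m * (\<eta> * m)" using z by (intro mult_left_mono) (auto simp: B5_def)
        finally show ?thesis by (simp add: mult_ac)
      qed
      show "4 * c * m \<le> card {v \<in> {..<n} - {u}. 0 < ?x v}" if "u < n" for u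
      proof -
        have "{v \<in> {..<n}. 0 < ?x v} \<subseteq> insert u {v \<in> {..<n} - {u}. 0 < ?x v}" by auto
        then have "card {v \<in> {..<n}. 0 < ?x v} \<le> card (insert u {v \<in> {..<n} - {u}. 0 < ?x v})"
          by (rule card_mono[rotated]) simp
        then have le: "real (card {v \<in> {..<n}. 0 < ?x v}) - 1 \<le> card {v \<in> {..<n} - {u}. 0 < ?x v}"
          by simp
        have "4 * c * m = p / (8 * b) * m" by (simp add: c_def)
        also have "\<dots> \<le> p / (8 * b) * (b * n)" using nm pos p by (intro mult_left_mono) auto
        also have "\<dots> = p / 8 * n" using pos by simp
        \<comment> \<open>From 8 / p <= n follows p n / 8 >= 1, which pays for the excluded vertex
          \<open>u\<close>.\<close>
        also have "\<dots> \<le> p * n / 4 - 1" using nm(3) p by (simp add: field_simps)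
        also have "\<dots> \<le> (\<Sum>v<n. indicator {z. 0 < z} (z v)) - 1" using z by (simp add: B3_def)
        also have "(\<Sum>v<n. indicator {z. 0 < z} (z v)) = real (card {v \<in> {..<n}. 0 < ?x v})"
          using m by (simp add: indicator_def sum.If_cases Int_def)
        also note le
        finally show ?thesis .
      qed
    qed (use n c pos nm in auto)
  qed
  have "measure_pmf.prob (active_rig n m (map_pmf (\<lambda>z. min z m) Z))
            {S. \<epsilon> < \<bar>clustering_coeff {..<n} (rig_edge S)\<bar>}
      \<le> measure_pmf.prob ?P (B1 \<union> B2 \<union> B3 \<union> B4 \<union> B5) + A * \<eta>"
    unfolding active_rig_eq_bind[OF m(1)] using main A0 pos by (intro prob_bind_pmf_le) auto
  also have "measure_pmf.prob ?P (B1 \<union> B2 \<union> B3 \<union> B4 \<union> B5) \<le> \<mu> / K + exp (- (1 / (\<eta> * real t ^ 2) * n))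
       + exp (- (p / 4 * n)) + b / \<eta> * tail_mean Z m + b / \<eta> * trunc_sq_mean Z m"
    by (intro order_trans[OF measure_Un_le] add_mono P1 P2 P3 P4 P5) auto
  finally show ?thesis by (simp add: A_def \<mu>_def)
qed

section \<open>Passage to the limit\<close>

text \<open>By monotone convergence the truncated second moments increase to the infinite second
  moment.\<close>

lemma ex_truncated_second_moment_ge:
  assumes "(\<integral>\<^sup>+ z. ennreal (real z ^ 2) \<partial>measure_pmf Z) = \<infinity>"
  shows "\<exists>t>0. r \<le> measure_pmf.expectation Z (\<lambda>z. real (min z t) ^ 2)"
proof -
  let ?f = "\<lambda>t z. ennreal (real (min z t) ^ 2)"
  have sup: "(SUP t. ?f t z) = ennreal (real z ^ 2)" for z
  proof (rule antisym)
    show "(SUP t. ?f t z) \<le> ennreal (real z ^ 2)"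
      by (intro SUP_least ennreal_leI power_mono) auto
    show "ennreal (real z ^ 2) \<le> (SUP t. ?f t z)"
      by (rule SUP_upper2[of z]) auto
  qed
  have "(\<integral>\<^sup>+ z. (SUP t. ?f t z) \<partial>measure_pmf Z) = (SUP t. \<integral>\<^sup>+ z. ?f t z \<partial>measure_pmf Z)"
    by (intro nn_integral_monotone_convergence_SUP)
       (auto simp: incseq_def le_fun_def intro!: ennreal_leI power_mono)
  \<comment> \<open>Replacing \<open>r\<close> by its positive part allows the comparison to be
    carried back to the reals and makes the moment strictly positive, which excludes t = 0.\<close>
  then have "ennreal (max r 0) < (SUP t. \<integral>\<^sup>+ z. ?f t z \<partial>measure_pmf Z)"
    using assms by (simp add: sup)
  then obtain t where t: "ennreal (max r 0) < (\<integral>\<^sup>+ z. ?f t z \<partial>measure_pmf Z)"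
    by (auto simp: less_SUP_iff)
  have "(\<integral>\<^sup>+ z. ?f t z \<partial>measure_pmf Z) = ennreal (measure_pmf.expectation Z (\<lambda>z. real (min z t) ^ 2))"
  proof (rule nn_integral_eq_integral)
    show "integrable (measure_pmf Z) (\<lambda>z. real (min z t) ^ 2)"
      by (rule measure_pmf.integrable_const_bound[where B = "real t ^ 2"]) (auto intro!: power_mono AE_pmfI)
  qed auto
  then have "max r 0 < measure_pmf.expectation Z (\<lambda>z. real (min z t) ^ 2)"
    using t by (simp only: ennreal_less_iff[OF max.cobounded2])
  moreover from this have "t \<noteq> 0" by (intro notI) auto
  ultimately show ?thesis by (intro exI[of _ t]) auto
qed

theorem theorem1:
  fixes \<beta> :: real and m n :: "nat \<Rightarrow> nat" and Z :: "nat pmf"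
  assumes "\<beta> > 0"
    and "filterlim m at_top sequentially"
    and "filterlim n at_top sequentially"
    and "(\<lambda>k. real (m k) / real (n k)) \<longlonglongrightarrow> \<beta>"
    and "(\<integral>\<^sup>+ z. ennreal (real z) \<partial>measure_pmf Z) < \<infinity>"
    and "(\<integral>\<^sup>+ z. ennreal (real z ^ 2) \<partial>measure_pmf Z) = \<infinity>"
  shows "\<forall>\<epsilon>>0. (\<lambda>k. measure_pmf.prob
            (active_rig (n k) (m k) (map_pmf (\<lambda>z. min z (m k)) Z))
            {S. \<bar>clustering_coeff {..<n k} (rig_edge S)\<bar> > \<epsilon>}) \<longlonglongrightarrow> 0"
proof (intro allI impI)
  fix \<epsilon> :: real assume \<epsilon>: "0 < \<epsilon>"
  define p where "p = measure_pmf.prob Z {z. 0 < z}"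
  \<comment> \<open>One constant for both directions: eventually m/n < \<open>\<beta>\<close> + 1
    and n/m < 2/\<open>\<beta>\<close>.\<close>
  define b where "b = max (\<beta> + 1) (2 / \<beta>)"
  define c where "c = p / (32 * b)"
  define \<mu> where "\<mu> = measure_pmf.expectation Z real"
  have Z: "integrable (measure_pmf Z) real"
    using assms(5) by (intro integrableI_bounded) auto
  \<comment> \<open>Otherwise Z would be 0 almost surely and its second moment would vanish.\<close>
  have p: "0 < p"
  proof (rule ccontr)
    assume "\<not> 0 < p"
    then have "measure_pmf.prob Z {z. 0 < z} = 0" by (simp add: p_def zero_less_measure_iff)
    then have "set_pmf Z \<inter> {z. 0 < z} = {}" by (simp add: measure_pmf_zero_iff)
    then have "(\<integral>\<^sup>+ z. ennreal (real z ^ 2) \<partial>measure_pmf Z) = (\<integral>\<^sup>+ z. 0 \<partial>measure_pmf Z)"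
      by (intro nn_integral_cong_AE AE_pmfI) auto
    then show False using assms(6) by simp
  qed
  have b: "0 < b" using assms(1) by (simp add: b_def)
  have c: "0 < c" using p b by (simp add: c_def)
  have \<mu>: "0 \<le> \<mu>" unfolding \<mu>_def by (rule integral_nonneg_AE) auto
  have ratio: "\<forall>\<^sub>F k in sequentially. real (n k) \<le> b * m k \<and> real (m k) \<le> b * n k"
  proof -
    have "\<forall>\<^sub>F k in sequentially. \<beta> / 2 < real (m k) / real (n k)"
      using assms(1,4) by (intro order_tendstoD(1)) auto
    moreover have "\<forall>\<^sub>F k in sequentially. real (m k) / real (n k) < \<beta> + 1"
      using assms(1,4) by (intro order_tendstoD(2)) auto
    moreover have "\<forall>\<^sub>F k in sequentially. 1 \<le> n k"
      using assms(3) by (simp add: filterlim_at_top)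
    ultimately show ?thesis
    proof eventually_elim
      case (elim k)
      then have "real (n k) \<le> 2 / \<beta> * m k" "real (m k) \<le> (\<beta> + 1) * n k"
        using assms(1) by (auto simp: field_simps)
      moreover have "2 / \<beta> * m k \<le> b * m k" "(\<beta> + 1) * n k \<le> b * n k"
        by (intro mult_right_mono; simp add: b_def)+
      ultimately show ?case by linarith
    qed
  qed
  show "(\<lambda>k. measure_pmf.prob (active_rig (n k) (m k) (map_pmf (\<lambda>z. min z (m k)) Z))
            {S. \<epsilon> < \<bar>clustering_coeff {..<n k} (rig_edge S)\<bar>}) \<longlonglongrightarrow> 0"
  proof (rule order_tendstoI)
    fix a :: real assume "a < 0"
    then show "\<forall>\<^sub>F k in sequentially. a < measure_pmf.prob (active_rig (n k) (m k) (map_pmf (\<lambda>z. min z (m k)) Z))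
            {S. \<epsilon> < \<bar>clustering_coeff {..<n k} (rig_edge S)\<bar>}"
      by (intro always_eventually allI) (auto intro: less_le_trans[OF _ measure_nonneg])
  next
    fix \<rho> :: real assume \<rho>: "0 < \<rho>"
    \<comment> \<open>The order of choice matters: \<open>K\<close> makes the first error term at
      most \<open>\<rho>\<close>/4, \<open>A\<close> depends on \<open>K\<close>, then
      \<open>\<eta>\<close> makes A \<open>\<eta>\<close> at most \<open>\<rho>\<close>/4, and the
      truncation level \<open>t\<close> depends on \<open>\<eta>\<close>. All of them are fixed
      before \<open>k\<close> grows.\<close>
    define K where "K = 4 * (\<mu> + 1) / \<rho>"
    define A where "A = 4 * K / c + 2 / c + 48 * (K ^ 3 * b\<^sup>2 + 1) / (\<epsilon> * c\<^sup>2)"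
    define \<eta> where "\<eta> = min 1 (min (\<epsilon> * c / 24) (\<rho> / (4 * A)))"
    have K: "0 < K" using \<rho> \<mu> by (simp add: K_def)
    have A: "0 < A" unfolding A_def using K c b \<epsilon> by (intro add_pos_pos divide_pos_pos mult_pos_pos) auto
    have \<eta>: "0 < \<eta>" "\<eta> \<le> 1" "24 * \<eta> \<le> \<epsilon> * c" "A * \<eta> \<le> \<rho> / 4"
    proof -
      show "0 < \<eta>" "\<eta> \<le> 1" using \<epsilon> c \<rho> A by (auto simp: \<eta>_def)
      have "\<eta> \<le> \<epsilon> * c / 24" "\<eta> \<le> \<rho> / (4 * A)" by (auto simp: \<eta>_def)
      then show "24 * \<eta> \<le> \<epsilon> * c" "A * \<eta> \<le> \<rho> / 4" using A by (auto simp: field_simps)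
    qed
    have \<mu>K: "\<mu> / K \<le> \<rho> / 4" using \<rho> \<mu> by (simp add: K_def field_simps)
    obtain t where t: "0 < t" "4 / \<eta> \<le> measure_pmf.expectation Z (\<lambda>z. real (min z t) ^ 2)"
      using ex_truncated_second_moment_ge[OF assms(6)] by blast
    define R where "R k = \<mu> / K + exp (- (1 / (\<eta> * real t ^ 2) * n k)) + exp (- (p / 4 * n k))
       + b / \<eta> * tail_mean Z (m k) + b / \<eta> * trunc_sq_mean Z (m k) + A * \<eta>" for k
    have exp0: "(\<lambda>k. exp (- (r * real (n k)))) \<longlonglongrightarrow> 0" if "0 < r" for r
      by (rule filterlim_compose[OF exp_at_bot], subst filterlim_uminus_at_bot, simp)
         (intro filterlim_tendsto_pos_mult_at_top[OF tendsto_const that]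
            filterlim_compose[OF filterlim_real_sequentially] assms(3))
    \<comment> \<open>Only the two constant terms survive, and they add up to at most
      \<open>\<rho>\<close>/2.\<close>
    have "R \<longlonglongrightarrow> \<mu> / K + 0 + 0 + b / \<eta> * 0 + b / \<eta> * 0 + A * \<eta>"
      unfolding R_def using \<eta> t p
      by (intro tendsto_add tendsto_mult tendsto_const exp0
          filterlim_compose[OF tail_mean_tendsto_0[OF Z] assms(2)]
          filterlim_compose[OF trunc_sq_mean_tendsto_0[OF Z] assms(2)]) auto
    then have "\<forall>\<^sub>F k in sequentially. R k < \<rho>"
      by (rule order_tendstoD(2)) (use \<mu>K \<eta>(4) \<rho> in linarith)
    moreover have "\<forall>\<^sub>F k in sequentially. max 2 t \<le> m k"
      using assms(2) by (simp only: filterlim_at_top)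
    moreover have "\<forall>\<^sub>F k in sequentially. nat \<lceil>8 / p\<rceil> \<le> n k"
      using assms(3) by (simp only: filterlim_at_top)
    ultimately show "\<forall>\<^sub>F k in sequentially. measure_pmf.prob (active_rig (n k) (m k) (map_pmf (\<lambda>z. min z (m k)) Z))
            {S. \<epsilon> < \<bar>clustering_coeff {..<n k} (rig_edge S)\<bar>} < \<rho>"
      using ratio
    proof eventually_elim
      case (elim k)
      have "8 / p \<le> n k" using elim(3) by linarith
      then have "measure_pmf.prob (active_rig (n k) (m k) (map_pmf (\<lambda>z. min z (m k)) Z))
            {S. \<epsilon> < \<bar>clustering_coeff {..<n k} (rig_edge S)\<bar>} \<le> R k"
        unfolding R_def A_def c_def p_def \<mu>_def
        using elim Z p b K \<eta> \<epsilon> t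
        by (intro prob_active_rig_clustering_le) (auto simp: p_def c_def)
      then show ?case using elim(1) by simp
    qed
  qed
qed

end
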